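(* For each integer $n\ge 1$ let $\sigma=\sigma^{(n)}\in\mathrm{Sym}(3^n)$ be the permutation of $\{1,\dots,3^n\}$ that swaps the digits $1\leftrightarrow 2$ in base $3$: if $x\in\{1,\dots,3^n\}$ and $x-1=\sum_{k=1}^n x_k3^{k-1}$ with $x_k\in\{0,1,2\}$, then $\sigma(x)-1=\sum_{k=1}^n y_k3^{k-1}$, where $y_k\in\{0,1,2\}$ and $y_k\equiv 2x_k \pmod 3$. Then there exist constants $C,p>0$ (independent of $n$) such that for all integers $n\ge1$, $$\mu\left(T^{3^n}_{\sigma}\right)\le Cn^{-p}.$$
   Context: $\mu$ denotes two-dimensional Lebesgue measure on $\mathbb{R}^2$. For integers $N\ge1$ and $1\le j,k\le N$, let $P^N_{j,k}=\{(x,y)\in\mathbb{R}^2: j-1\le Nx-(k-j)y\le j,\ y\in[0,1]\}$, the parallelogram with parallel sides $[(j-1)/N,j/N]\times\{0\}$ and $[(k-1)/N,k/N]\times\{1\}$. For a permutation $\sigma\in\mathrm{Sym}(N)$ of $\{1,\dots,N\}$, let $T^N_\sigma=\bigcup_{j=1}^N P^N_{j,\sigma(j)}$. *)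

theory Defs
  imports "HOL-Analysis.Analysis"
begin

definition parallelogram :: "nat \<Rightarrow> nat \<Rightarrow> nat \<Rightarrow> (real \<times> real) set" where
  "parallelogram N j k =
     {(x, y). real j - 1 \<le> real N * x - (real k - real j) * y \<and>
              real N * x - (real k - real j) * y \<le> real j \<and> y \<in> {0..1}}"

definition parallelogram_union :: "nat \<Rightarrow> (nat \<Rightarrow> nat) \<Rightarrow> (real \<times> real) set" where
  "parallelogram_union N \<sigma> = (\<Union>j\<in>{1..N}. parallelogram N j (\<sigma> j))"

text \<open>Base-3 digits are numbered from \<open>1\<close>, least significant first, and \<open>m = x - 1\<close> is the number
  whose digits are changed.\<close>

definition ternary_digit :: "nat \<Rightarrow> nat \<Rightarrow> nat" where
  "ternary_digit m k = m div 3 ^ (k - 1) mod 3"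

text \<open>Outside \<open>{1..3 ^ n}\<close> the map is the identity, as \<open>permutes\<close> requires.\<close>

definition digit_swap :: "nat \<Rightarrow> nat \<Rightarrow> nat" where
  "digit_swap n x =
     (if x \<in> {1..3 ^ n}
      then 1 + (\<Sum>k=1..n. (2 * ternary_digit (x - 1) k mod 3) * 3 ^ (k - 1))
      else x)"

lemma ternary_sum_less:
  assumes "\<And>k. k \<in> {1..n} \<Longrightarrow> d k < 3"
  shows "(\<Sum>k=1..n. d k * 3 ^ (k - 1)) < (3::nat) ^ n"
  using assms
proof (induction n)
  case (Suc n)
  have "(\<Sum>k=1..n. d k * 3 ^ (k - 1)) < (3::nat) ^ n"
    using Suc by simp
  moreover have "d (Suc n) * 3 ^ n \<le> 2 * 3 ^ n"
    using Suc.prems[of "Suc n"] by (intro mult_right_mono) auto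
  ultimately have "(\<Sum>k=1..n. d k * 3 ^ (k - 1)) + d (Suc n) * 3 ^ n < 3 ^ n + 2 * 3 ^ n"
    by (rule add_less_le_mono)
  then show ?case by simp
qed simp

lemma ternary_digit_sum:
  assumes "\<And>k. k \<in> {1..n} \<Longrightarrow> d k < 3" and "k \<in> {1..n}"
  shows "ternary_digit (\<Sum>i=1..n. d i * 3 ^ (i - 1)) k = d k"
  using assms
proof (induction n)
  case (Suc n)
  let ?s = "\<Sum>i=1..n. d i * 3 ^ (i - 1)"
  have less: "?s < 3 ^ n"
    using Suc.prems by (intro ternary_sum_less) auto
  show ?case
  proof (cases "k = Suc n")
    case True
    have "(?s + d (Suc n) * 3 ^ n) div 3 ^ n = d (Suc n)"
      using less by simp
    then show ?thesis
      using True Suc.prems(1)[of "Suc n"] by (simp add: ternary_digit_def)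
  next
    case False
    then have k: "1 \<le> k" "k \<le> n" using Suc.prems by auto
    then have "n = (k - 1) + Suc (n - k)" by simp
    then have pow: "(3::nat) ^ n = 3 ^ (k - 1) * (3 * 3 ^ (n - k))"
      by (metis power_Suc power_add)
    have "?s + d (Suc n) * 3 ^ n = ?s + 3 ^ (k - 1) * (3 * (d (Suc n) * 3 ^ (n - k)))"
      unfolding pow by (simp only: mult.left_commute)
    then have "(?s + d (Suc n) * 3 ^ n) div 3 ^ (k - 1) =
        ?s div 3 ^ (k - 1) + 3 * (d (Suc n) * 3 ^ (n - k))"
      by (simp only: div_mult_self2 power_not_zero) simp
    then have "ternary_digit (?s + d (Suc n) * 3 ^ n) k = ternary_digit ?s k"
      by (simp add: ternary_digit_def)
    also have "\<dots> = d k"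
      using Suc.prems k by (intro Suc.IH) auto
    finally show ?thesis by simp
  qed
qed simp

lemma sum_ternary_digit:
  "(\<Sum>k=1..n. ternary_digit m k * 3 ^ (k - 1)) = m mod 3 ^ n"
proof (induction n)
  case (Suc n)
  have "m mod 3 ^ Suc n = 3 ^ n * (m div 3 ^ n mod 3) + m mod 3 ^ n"
    unfolding power_Suc2 by (rule mod_mult2_eq)
  then show ?case
    using Suc by (simp add: ternary_digit_def)
qed simp

lemma digit_swap_eq:
  assumes "\<And>k. k \<in> {1..n} \<Longrightarrow> d k \<in> {0, 1, 2}"
  shows "digit_swap n (1 + (\<Sum>k=1..n. d k * 3 ^ (k - 1))) =
    1 + (\<Sum>k=1..n. (2 * d k mod 3) * 3 ^ (k - 1))"
proof -
  have d: "d k < 3" if "k \<in> {1..n}" for k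
    using assms[OF that] by auto
  show ?thesis
    using ternary_sum_less[of n d, OF d] ternary_digit_sum[of n d, OF d]
    by (auto simp: digit_swap_def intro!: sum.cong)
qed

lemma digit_swap_permutes: "digit_swap n permutes {1..3 ^ n}"
proof -
  have mem: "digit_swap n x \<in> {1..3 ^ n}" if "x \<in> {1..3 ^ n}" for x
    using that ternary_sum_less[of n "\<lambda>k. 2 * ternary_digit (x - 1) k mod 3"]
    by (auto simp: digit_swap_def)
  have invol: "digit_swap n (digit_swap n x) = x" if "x \<in> {1..3 ^ n}" for x
  proof -
    let ?e = "\<lambda>k. 2 * ternary_digit (x - 1) k mod 3"
    have "digit_swap n (digit_swap n x) = digit_swap n (1 + (\<Sum>k=1..n. ?e k * 3 ^ (k - 1)))"
      using that by (simp add: digit_swap_def)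
    also have "\<dots> = 1 + (\<Sum>k=1..n. (2 * ?e k mod 3) * 3 ^ (k - 1))"
    proof (rule digit_swap_eq)
      have "2 * m mod 3 \<in> {0, 1, 2}" for m :: nat
        unfolding insert_iff empty_iff by presburger
      then show "?e k \<in> {0, 1, 2}" for k by this
    qed
    also have "\<dots> = 1 + (\<Sum>k=1..n. ternary_digit (x - 1) k * 3 ^ (k - 1))"
    proof -
      have "2 * (2 * (m mod 3) mod 3) mod 3 = m mod 3" for m :: nat
      proof -
        have "m mod 3 = 0 \<or> m mod 3 = 1 \<or> m mod 3 = 2" by linarith
        then show ?thesis by (elim disjE) simp_all
      qed
      then have "2 * ?e k mod 3 = ternary_digit (x - 1) k" for k
        by (simp only: ternary_digit_def)
      then show ?thesis by simp
    qed
    also have "\<dots> = x"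
      using that unfolding sum_ternary_digit by auto
    finally show ?thesis .
  qed
  have "bij_betw (digit_swap n) {1..3 ^ n} {1..3 ^ n}"
    by (rule bij_betw_byWitness[where f' = "digit_swap n"]) (use mem invol in auto)
  then show ?thesis
    by (rule bij_imp_permutes) (auto simp: digit_swap_def)
qed

lemma compact_parallelogram:
  assumes "N \<ge> 1"
  shows "compact (parallelogram N j k)"
proof -
  let ?f = "\<lambda>(u, y). ((u + (real k - real j) * y) / real N, y)"
  have "parallelogram N j k = ?f ` ({real j - 1..real j} \<times> {0..1})"
  proof (intro equalityI subsetI)
    fix p assume "p \<in> parallelogram N j k"
    then show "p \<in> ?f ` ({real j - 1..real j} \<times> {0..1})"
      using assms
      by (intro image_eqI[where x = "(real N * fst p - (real k - real j) * snd p, snd p)"])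
        (auto simp: parallelogram_def)
  qed (use assms in \<open>auto simp: parallelogram_def\<close>)
  moreover have "continuous_on ({real j - 1..real j} \<times> {0..1}) ?f"
    unfolding case_prod_unfold using assms by (intro continuous_intros) simp
  ultimately show ?thesis
    by (simp add: compact_continuous_image compact_Times)
qed

text \<open>Hence the real-valued \<open>measure\<close> of these sets is their actual area, not a default value.\<close>

lemma lmeasurable_parallelogram_union:
  "N \<ge> 1 \<Longrightarrow> parallelogram_union N \<sigma> \<in> lmeasurable"
  unfolding parallelogram_union_def
  by (intro lmeasurable_compact compact_UN compact_parallelogram) auto

end

theory Submission
  imports Defs
begin

text \<open>At height \<open>y\<close> the union of parallelograms is, after scaling by \<open>3 ^ n\<close>, a union of \<open>3 ^ n\<close> unit
  intervals. Their left ends \<open>pos y w\<close> are the numbers whose base-3 expansions use the digits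
  \<open>0\<close>, \<open>1 + y\<close>, \<open>2 - y\<close> in place of \<open>0\<close>, \<open>1\<close>, \<open>2\<close>. So the slices are the stages of a self-similar
  set, a projection of a one-dimensional Sierpinski gasket, and the claim is a power law for the mean
  length of these projections. Both the stages and the words \<open>w\<close> are self-similar: a word of length
  \<open>i + m\<close> is a prefix of length \<open>i\<close> followed by a suffix of length \<open>m\<close>.

  Fix a large \<open>K\<close>. A word is crowded if the box \<open>{b..<b + 1}\<close> that contains its left end, or one of the
  two neighbouring boxes, contains the left ends of at least \<open>K\<close> words of the same length. If at some
  level \<open>i\<close> a proportion \<open>d\<close> of all words is crowded, then the intervals of these words overlap so much
  that they cover at most a fraction of order \<open>1 / K\<close> of their total length. Iterating this on suffixes
  makes the slices decay geometrically, until a length of order \<open>3 ^ n / K\<close> is left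
  (\<open>measure_slice_decay\<close>). If, on the contrary, crowded words are very rare at all levels up to \<open>N\<close>,
  then the number of pairs of words of length \<open>n\<close> with left ends at distance less than \<open>1\<close> is
  \<open>O(K * 3 ^ n)\<close> for all \<open>n \<le> N\<close>, as one sees by splitting a pair at its first crowded prefix
  (\<open>card_close_pairs_if_few_crowded\<close>).

  The second alternative is excluded by Fourier analysis for all \<open>y\<close> outside a small set. The number
  of close pairs controls the mean square over \<open>{0..1}\<close> of the exponential sum \<open>exp_sum y N\<close>, which is
  a product of one trinomial \<open>1 + cis a + cis b\<close> for each level. Consider a window
  \<open>{1 / 3 ^ i..X / 3 ^ i}\<close> of frequencies. The levels of the prefixes of length \<open>N - i\<close>
  form, up to a rescaling of the frequency, an exponential sum whose mean square over \<open>{1..X}\<close> is large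
  because of the diagonal pairs, once \<open>X\<close> is a large multiple of \<open>K\<close>. The other factors are bounded
  below pointwise by a power of \<open>1 / X\<close>, relative to their value at frequency \<open>0\<close>, since
  \<open>3 * cmod (1 + cis a + cis b) \<ge> \<bar>1 + 2 * cos a\<bar>\<close> and the product of \<open>1 + 2 * cos a\<close> over the levels
  telescopes: \<open>1 + 2 * cos a\<close> is the quotient of \<open>sin (3 * a / 2)\<close> by \<open>sin (a / 2)\<close>. So every window
  contributes at least \<open>3 ^ N\<close> times a power of \<open>1 / X\<close>, and a number of disjoint windows polynomial in
  \<open>X\<close> exceeds the bound from above (\<open>many_crowded_if_nonresonant\<close>).

  The pointwise bound needs that \<open>sin ((1 + y) * \<tau> / 2)\<close> and \<open>sin ((2 - y) * \<tau> / 2)\<close> are never both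
  tiny for \<open>\<tau> \<in> {1..X}\<close>. Where they are, \<open>(1 + y) / 3\<close> is very close to a fraction with denominator at
  most \<open>X\<close>, and the set of such \<open>y\<close> has measure \<open>O(1 / X)\<close>. All parameters are polynomial in \<open>X\<close>, so
  the integral over \<open>y\<close> is \<open>O(1 / X)\<close> with \<open>X\<close> of the order of a fixed power of \<open>n\<close>.\<close>

section \<open>Words and the left ends of slice intervals\<close>

text \<open>A digit \<open>c\<close> of \<open>j - 1\<close> turns into \<open>2 * c mod 3\<close> from the bottom to the top of the \<open>j\<close>-th parallelogram,
  so at height \<open>y\<close> it counts with the interpolated weight.\<close>

definition digit_weight :: "real \<Rightarrow> nat \<Rightarrow> real" where
  "digit_weight y c = (1 - y) * real c + y * real (2 * c mod 3)"

text \<open>A natural number below \<open>3 ^ n\<close> stands for a word of length \<open>n\<close> over three digits. Leading zeros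
  contribute nothing, so the length need not be an argument.\<close>

fun pos :: "real \<Rightarrow> nat \<Rightarrow> real" where
  "pos y m = (if m = 0 then 0 else digit_weight y (m mod 3) + 3 * pos y (m div 3))"

declare pos.simps [simp del]

lemma digit_weight_simps [simp]:
  "digit_weight y 0 = 0" "digit_weight y (Suc 0) = 1 + y" "digit_weight y 2 = 2 - y"
  by (simp_all add: digit_weight_def algebra_simps)

lemma pos_0 [simp]: "pos y 0 = 0"
  by (simp add: pos.simps)

lemma pos_rec: "pos y m = digit_weight y (m mod 3) + 3 * pos y (m div 3)"
  by (cases "m = 0") (simp_all add: pos.simps[of y m])

lemma pos_digit: "c < 3 \<Longrightarrow> pos y c = digit_weight y c"
  by (subst pos_rec) simp

lemma pos_concat: "b < 3 ^ m \<Longrightarrow> pos y (a * 3 ^ m + b) = 3 ^ m * pos y a + pos y b"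
proof (induction m arbitrary: b)
  case (Suc m)
  have split: "(a * 3 ^ Suc m + b) mod 3 = b mod 3"
    "(a * 3 ^ Suc m + b) div 3 = a * 3 ^ m + b div 3"
    by (simp_all add: mod_add_eq[symmetric] div_plus_div_distrib_dvd_left)
  have "b div 3 < 3 ^ m"
    using Suc.prems by auto
  then have "pos y (a * 3 ^ Suc m + b) = digit_weight y (b mod 3) + 3 * (3 ^ m * pos y a + pos y (b div 3))"
    by (subst pos_rec) (simp only: split Suc.IH)
  also have "\<dots> = 3 ^ Suc m * pos y a + pos y b"
    using pos_rec[of y b] by simp
  finally show ?case .
qed simp

lemma word_split:
  assumes "(w::nat) < 3 ^ n" "i \<le> n"
  shows "w div 3 ^ (n - i) < 3 ^ i" "w mod 3 ^ (n - i) < 3 ^ (n - i)"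
    "w = w div 3 ^ (n - i) * 3 ^ (n - i) + w mod 3 ^ (n - i)"
proof -
  show "w div 3 ^ (n - i) < 3 ^ i"
    using assms by (simp add: less_mult_imp_div_less flip: power_add)
  show "w = w div 3 ^ (n - i) * 3 ^ (n - i) + w mod 3 ^ (n - i)"
    by (simp only: div_mult_mod_eq)
qed simp

text \<open>Together with \<open>pos_concat\<close> the next three lemmas express self-similarity: words of length \<open>i + m\<close>
  are pairs of a prefix and a suffix.\<close>

lemma concat_less:
  assumes "u < 3 ^ i" "v < (3::nat) ^ m"
  shows "u * 3 ^ m + v < 3 ^ (i + m)"
proof -
  have "u * 3 ^ m + v < u * 3 ^ m + 1 * 3 ^ m" using assms by simp
  also have "\<dots> = (u + 1) * 3 ^ m" by simp
  also have "\<dots> \<le> 3 ^ i * 3 ^ m" using assms by (intro mult_right_mono) auto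
  finally show ?thesis by (simp add: power_add)
qed

lemma words_concat_image:
  "{..<3 ^ (i + m)} = (\<lambda>(u, v). u * 3 ^ m + v) ` ({..<3 ^ i} \<times> {..<(3::nat) ^ m})"
proof (intro equalityI subsetI)
  fix w :: nat assume "w \<in> {..<3 ^ (i + m)}"
  then show "w \<in> (\<lambda>(u, v). u * 3 ^ m + v) ` ({..<3 ^ i} \<times> {..<3 ^ m})"
    using word_split[of w "i + m" i]
    by (intro image_eqI[where x = "(w div 3 ^ m, w mod 3 ^ m)"]) auto
qed (auto simp: concat_less)

lemma inj_on_concat: "inj_on (\<lambda>(u, v). u * 3 ^ m + v) (A \<times> {..<(3::nat) ^ m})"
proof (rule inj_onI)
  fix p q :: "nat \<times> nat"
  assume *: "p \<in> A \<times> {..<3 ^ m}" "q \<in> A \<times> {..<3 ^ m}"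
    "(\<lambda>(u, v). u * 3 ^ m + v) p = (\<lambda>(u, v). u * 3 ^ m + v) q"
  then have eq: "fst p * 3 ^ m + snd p = fst q * 3 ^ m + snd q"
    by (simp add: case_prod_unfold)
  have "(fst p * 3 ^ m + snd p) div 3 ^ m = fst p" "(fst q * 3 ^ m + snd q) div 3 ^ m = fst q"
    using *(1,2) by auto
  then have "fst p = fst q" by (simp only: eq)
  with eq show "p = q" by (simp add: prod_eq_iff)
qed

text \<open>The digits lie between \<open>0\<close> and \<open>2\<close>, so the left ends lie between \<open>0\<close> and
  \<open>2 * (1 + 3 + \<dots> + 3 ^ (m - 1))\<close>.\<close>

lemma pos_bounds:
  assumes "0 \<le> y" "y \<le> 1"
  shows "b < 3 ^ m \<Longrightarrow> 0 \<le> pos y b \<and> pos y b \<le> 3 ^ m - 1"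
proof (induction m arbitrary: b)
  case (Suc m)
  have "b div 3 < 3 ^ m"
    using Suc.prems by auto
  note IH = Suc.IH[OF this]
  have "b mod 3 = 0 \<or> b mod 3 = Suc 0 \<or> b mod 3 = 2" by linarith
  then have "0 \<le> digit_weight y (b mod 3) \<and> digit_weight y (b mod 3) \<le> 2"
    using assms by auto
  with IH show ?case
    by (subst (1 2) pos_rec) (auto simp: algebra_simps)
qed simp

section \<open>Close pairs and crowded words\<close>

definition close_pairs :: "real \<Rightarrow> nat \<Rightarrow> (nat \<times> nat) set" where
  "close_pairs y n = {(w, w'). w < 3 ^ n \<and> w' < 3 ^ n \<and> \<bar>pos y w - pos y w'\<bar> < 1}"

definition box_count :: "real \<Rightarrow> nat \<Rightarrow> int \<Rightarrow> nat" where
  "box_count y n b = card {w. w < 3 ^ n \<and> \<lfloor>pos y w\<rfloor> = b}"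

text \<open>Looking at the neighbouring boxes as well makes the notion insensitive to the rounding: all words
  close to an uncrowded word lie in three boxes with fewer than \<open>K\<close> words each.\<close>

definition crowded :: "real \<Rightarrow> real \<Rightarrow> nat \<Rightarrow> nat set" where
  "crowded y K n = {w. w < 3 ^ n \<and> (\<exists>b. \<bar>b - \<lfloor>pos y w\<rfloor>\<bar> \<le> 1 \<and> K \<le> real (box_count y n b))}"

text \<open>The number of coincidences of two functions is \<open>\<Sum>k. N k * M k\<close>, where \<open>N\<close> and \<open>M\<close> count the fibres,
  and \<open>2 * N k * M k \<le> N k * N k + M k * M k\<close>.\<close>

lemma card_coincidences_le:
  fixes F :: "'a \<Rightarrow> 'c" and G :: "'b \<Rightarrow> 'c"
  assumes "finite A" "finite B"
  shows "2 * card {(a, b). a \<in> A \<and> b \<in> B \<and> F a = G b}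
      \<le> card {(a, a'). a \<in> A \<and> a' \<in> A \<and> F a = F a'} + card {(b, b'). b \<in> B \<and> b' \<in> B \<and> G b = G b'}"
proof -
  define I where "I = F ` A \<union> G ` B"
  define N where "N k = card {a \<in> A. F a = k}" for k
  define M where "M k = card {b \<in> B. G b = k}" for k
  have "finite I" using assms by (simp add: I_def)
  have count: "card {(p, q). p \<in> P \<and> q \<in> Q \<and> f p = g q} =
      (\<Sum>k\<in>I. card {p \<in> P. f p = k} * card {q \<in> Q. g q = k})"
    if "finite P" "finite Q" "f ` P \<subseteq> I" for P :: "'p set" and Q :: "'q set" and f :: "'p \<Rightarrow> 'c" and g
  proof -
    have "{(p, q). p \<in> P \<and> q \<in> Q \<and> f p = g q} = (\<Union>k\<in>I. {p \<in> P. f p = k} \<times> {q \<in> Q. g q = k})"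
      using that(3) by auto
    also have "card \<dots> = (\<Sum>k\<in>I. card ({p \<in> P. f p = k} \<times> {q \<in> Q. g q = k}))"
      using that \<open>finite I\<close> by (intro card_UN_disjoint) auto
    finally show ?thesis by (simp add: card_cartesian_product)
  qed
  have "2 * (N k * M k) \<le> N k * N k + M k * M k" for k
  proof -
    have "real (2 * (N k * M k)) \<le> real (N k * N k + M k * M k)"
      using sum_squares_bound[of "real (N k)" "real (M k)"] by (simp add: power2_eq_square)
    then show ?thesis by (simp only: of_nat_le_iff)
  qed
  then have "(\<Sum>k\<in>I. 2 * (N k * M k)) \<le> (\<Sum>k\<in>I. N k * N k + M k * M k)"
    by (intro sum_mono) auto
  then show ?thesis
    using assms by (subst (1 2 3) count) (auto simp: I_def N_def M_def sum_distrib_left sum.distrib)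
qed

text \<open>Rounding reduces closeness to the coincidence of \<open>\<lfloor>f a\<rfloor>\<close> with \<open>\<lfloor>g b\<rfloor>\<close> shifted by \<open>-1\<close>, \<open>0\<close> or \<open>1\<close>,
  and elements with the same integer part are close.\<close>

lemma card_offset_close_pairs_le:
  fixes f g :: "'a \<Rightarrow> real"
  assumes "finite A"
  shows "2 * card {(a, b). a \<in> A \<and> b \<in> A \<and> \<bar>f a - g b\<bar> < 1}
      \<le> 3 * (card {(a, a'). a \<in> A \<and> a' \<in> A \<and> \<bar>f a - f a'\<bar> < 1}
           + card {(b, b'). b \<in> A \<and> b' \<in> A \<and> \<bar>g b - g b'\<bar> < 1})"
    (is "2 * card ?S \<le> 3 * (?T1 + ?T2)")
proof -
  let ?C = "\<lambda>s. {(a, b). a \<in> A \<and> b \<in> A \<and> \<lfloor>f a\<rfloor> = \<lfloor>g b\<rfloor> + s}"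
  have fin: "finite {(a, b). a \<in> A \<and> b \<in> A \<and> P a b}" for P
    by (rule finite_subset[of _ "A \<times> A"]) (use assms in auto)
  have "?S \<subseteq> (\<Union>s\<in>{-1, 0, 1}. ?C s)"
  proof clarify
    fix a b assume "a \<in> A" "b \<in> A" "\<bar>f a - g b\<bar> < 1"
    then have "\<lfloor>f a\<rfloor> - \<lfloor>g b\<rfloor> \<in> {-1, 0, 1 :: int}"
      by (simp add: insert_iff) linarith
    then show "(a, b) \<in> (\<Union>s\<in>{-1, 0, 1}. ?C s)"
      using \<open>a \<in> A\<close> \<open>b \<in> A\<close> by auto
  qed
  then have "card ?S \<le> card (\<Union>s\<in>{-1, 0, 1}. ?C s)"
    by (intro card_mono finite_UN_I) (auto intro!: fin)
  also have "\<dots> \<le> (\<Sum>s\<in>{-1, 0, 1}. card (?C s))"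
    by (intro card_UN_le) auto
  also have "2 * \<dots> \<le> (\<Sum>s\<in>{-1, 0, 1 :: int}. ?T1 + ?T2)"
    unfolding sum_distrib_left
  proof (rule sum_mono)
    fix s :: int
    have "2 * card (?C s) \<le> card {(a, a'). a \<in> A \<and> a' \<in> A \<and> \<lfloor>f a\<rfloor> = \<lfloor>f a'\<rfloor>}
        + card {(b, b'). b \<in> A \<and> b' \<in> A \<and> \<lfloor>g b\<rfloor> + s = \<lfloor>g b'\<rfloor> + s}"
      by (rule card_coincidences_le[OF assms assms])
    also have "\<dots> \<le> ?T1 + ?T2"
      by (intro add_mono card_mono fin) (clarsimp, linarith)+
    finally show "2 * card (?C s) \<le> ?T1 + ?T2" .
  qed
  finally show ?thesis by simp
qed

lemma finite_close_pairs [simp]: "finite (close_pairs y n)"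
  by (rule finite_subset[of _ "{..<3 ^ n} \<times> {..<3 ^ n}"]) (auto simp: close_pairs_def)

lemma finite_crowded [simp]: "finite (crowded y K n)"
  by (rule finite_subset[of _ "{..<3 ^ n}"]) (auto simp: crowded_def)

text \<open>A translation of one of two copies of the word set cannot create many more close pairs than there
  are without it. This allows pairs of suffixes to be counted whatever their prefixes are.\<close>

lemma card_offset_close_le:
  "card {(v, v'). v < 3 ^ n \<and> v' < 3 ^ n \<and> \<bar>pos y v - pos y v' + t\<bar> < 1} \<le> 3 * card (close_pairs y n)"
  using card_offset_close_pairs_le[of "{..<3 ^ n}" "pos y" "\<lambda>v. pos y v - t"]
  by (simp add: close_pairs_def algebra_simps)

text \<open>The threshold \<open>1\<close> for closeness is inherited by prefixes because suffixes of length \<open>m\<close> move a left end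
  by at most \<open>3 ^ m - 1\<close>.\<close>

lemma close_prefix:
  assumes "0 \<le> y" "y \<le> 1" "v < 3 ^ m" "v' < 3 ^ m"
    and "\<bar>pos y (u * 3 ^ m + v) - pos y (u' * 3 ^ m + v')\<bar> < 1"
  shows "\<bar>pos y u - pos y u'\<bar> < 1"
proof -
  have "3 ^ m * \<bar>pos y u - pos y u'\<bar> = \<bar>3 ^ m * pos y u - 3 ^ m * pos y u'\<bar>"
    by (simp add: abs_mult flip: right_diff_distrib)
  also have "\<dots> < 3 ^ m * 1"
    using assms(5) pos_bounds[OF assms(1-3)] pos_bounds[OF assms(1,2,4)]
    unfolding pos_concat[OF assms(3)] pos_concat[OF assms(4)] by linarith
  finally show ?thesis by simp
qed

lemma card_close_uncrowded:
  assumes "w < 3 ^ n" "w \<notin> crowded y K n"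
  shows "real (card {w'. w' < 3 ^ n \<and> \<bar>pos y w - pos y w'\<bar> < 1}) \<le> 3 * K"
proof -
  let ?B = "\<lambda>s. {w'. w' < 3 ^ n \<and> \<lfloor>pos y w'\<rfloor> = \<lfloor>pos y w\<rfloor> + s}"
  have "{w'. w' < 3 ^ n \<and> \<bar>pos y w - pos y w'\<bar> < 1} \<subseteq> (\<Union>s\<in>{-1, 0, 1}. ?B s)"
  proof clarify
    fix w' :: nat assume "w' < 3 ^ n" "\<bar>pos y w - pos y w'\<bar> < 1"
    then have "\<lfloor>pos y w'\<rfloor> - \<lfloor>pos y w\<rfloor> \<in> {-1, 0, 1 :: int}"
      by (simp add: insert_iff) linarith
    then show "w' \<in> (\<Union>s\<in>{-1, 0, 1}. ?B s)"
      using \<open>w' < 3 ^ n\<close> by auto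
  qed
  then have "card {w'. w' < 3 ^ n \<and> \<bar>pos y w - pos y w'\<bar> < 1} \<le> card (\<Union>s\<in>{-1, 0, 1}. ?B s)"
    by (intro card_mono) auto
  also have "\<dots> \<le> (\<Sum>s\<in>{-1, 0, 1}. card (?B s))"
    by (intro card_UN_le) auto
  also have "real \<dots> \<le> (\<Sum>s\<in>{-1, 0, 1::int}. K)"
    unfolding of_nat_sum
  proof (rule sum_mono)
    fix s :: int assume "s \<in> {-1, 0, 1}"
    then have "\<bar>(\<lfloor>pos y w\<rfloor> + s) - \<lfloor>pos y w\<rfloor>\<bar> \<le> 1" by auto
    then have "\<not> K \<le> real (box_count y n (\<lfloor>pos y w\<rfloor> + s))"
      using assms unfolding crowded_def by blast
    then show "real (card (?B s)) \<le> K" by (simp add: box_count_def)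
  qed
  finally show ?thesis by simp
qed

lemma crowded_0:
  assumes "1 < K"
  shows "crowded y K 0 = {}"
proof -
  have "box_count y 0 b \<le> 1" for b
    unfolding box_count_def using card_mono[of "{0::nat}" "{w. w < 3 ^ 0 \<and> \<lfloor>pos y w\<rfloor> = b}"] by auto
  then have "real (box_count y 0 b) < K" for b
    using assms by (intro le_less_trans[OF _ assms]) simp
  then show ?thesis
    by (auto simp: crowded_def not_le[symmetric])
qed

text \<open>The set \<open>Z i m\<close> collects the close pairs whose first word has a crowded prefix at level \<open>Suc i\<close> but
  not at level \<open>i\<close>. The second word has a prefix close to that of the first. At level \<open>i\<close> there are at
  most \<open>3 * K\<close> of these since the prefix of the first word is uncrowded there, so there are at most
  \<open>9 * K\<close> at level \<open>Suc i\<close>. The two suffixes form a close pair up to an offset, which explains the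
  remaining factor \<open>3\<close>.\<close>

lemma card_close_pairs_first_crowded:
  assumes y: "0 \<le> y" "y \<le> 1" and K: "0 \<le> K"
  defines "Z \<equiv> \<lambda>i m. {(w, w') \<in> close_pairs y (Suc i + m).
      w div 3 ^ m \<in> crowded y K (Suc i) \<and> w div 3 ^ Suc m \<notin> crowded y K i}"
  shows "real (card (Z i m))
    \<le> 27 * K * (real (card (crowded y K (Suc i))) * real (card (close_pairs y m)))"
proof -
  let ?U = "{u \<in> crowded y K (Suc i). u div 3 \<notin> crowded y K i}"
  define V where "V u = {u'. u' < 3 ^ Suc i \<and> \<bar>pos y (u div 3) - pos y (u' div 3)\<bar> < 1}" for u
  define W where "W u u' = {(v, v'). v < 3 ^ m \<and> v' < 3 ^ m
      \<and> \<bar>pos y v - pos y v' + 3 ^ m * (pos y u - pos y u')\<bar> < 1}" for u u'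
  define J where "J = Sigma ?U V"
  have finV: "finite (V u)" for u
    unfolding V_def by (rule finite_subset[of _ "{..<3 ^ Suc i}"]) auto
  have finW: "finite (W u u')" for u u'
    unfolding W_def by (rule finite_subset[of _ "{..<3 ^ m} \<times> {..<3 ^ m}"]) auto
  have cardW: "card (W u u') \<le> 3 * card (close_pairs y m)" for u u'
    unfolding W_def by (rule card_offset_close_le)
  have finJ: "finite J"
    unfolding J_def using finV by (intro finite_SigmaI) auto
  have cardV: "real (card (V u)) \<le> 9 * K" if "u \<in> ?U" for u
  proof -
    have u: "u div 3 < 3 ^ i"
      using that by (auto simp: crowded_def)
    let ?P = "{p. p < 3 ^ i \<and> \<bar>pos y (u div 3) - pos y p\<bar> < 1}"
    have "V u \<subseteq> (\<lambda>(p, c). p * 3 + c) ` (?P \<times> {..<3})"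
    proof
      fix u' assume "u' \<in> V u"
      then show "u' \<in> (\<lambda>(p, c). p * 3 + c) ` (?P \<times> {..<3})"
        by (intro image_eqI[where x = "(u' div 3, u' mod 3)"]) (auto simp: V_def)
    qed
    then have "card (V u) \<le> card (?P \<times> {..<3::nat})"
      by (rule surj_card_le[rotated]) simp
    also have "real \<dots> \<le> 9 * K"
      using card_close_uncrowded[of "u div 3" i y K] u that by simp
    finally show ?thesis by simp
  qed
  have "Z i m \<subseteq> (\<Union>(u, u')\<in>J. (\<lambda>(v, v'). (u * 3 ^ m + v, u' * 3 ^ m + v')) ` W u u')"
  proof (clarify, goal_cases)
    case (1 w w')
    define u v u' v' where "u = w div 3 ^ m" and "v = w mod 3 ^ m"
      and "u' = w' div 3 ^ m" and "v' = w' mod 3 ^ m"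
    have w: "w = u * 3 ^ m + v" "w' = u' * 3 ^ m + v'"
      unfolding u_def v_def u'_def v'_def by (simp_all only: div_mult_mod_eq)
    have v: "v < 3 ^ m" "v' < 3 ^ m" by (simp_all add: v_def v'_def)
    have *: "w < 3 ^ (Suc i + m)" "w' < 3 ^ (Suc i + m)" and close: "\<bar>pos y w - pos y w'\<bar> < 1"
      and u: "u \<in> crowded y K (Suc i)" "u div 3 \<notin> crowded y K i"
      using 1 by (auto simp: Z_def close_pairs_def u_def div_mult2_eq mult.commute[of 3])
    have u': "u' < 3 ^ Suc i"
      using word_split(1)[OF *(2), of "Suc i"] by (simp add: u'_def)
    have close_u: "\<bar>pos y u - pos y u'\<bar> < 1"
      using close_prefix[OF y v] close by (simp add: w)
    have "\<bar>pos y (u div 3) - pos y (u' div 3)\<bar> < 1"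
      using close_prefix[OF y, of "u mod 3" 1 "u' mod 3" "u div 3" "u' div 3"] close_u by simp
    with u u' have "(u, u') \<in> J" by (auto simp: J_def V_def)
    moreover have "(v, v') \<in> W u u'"
      using close v unfolding w pos_concat[OF v(1)] pos_concat[OF v(2)]
      by (simp add: W_def algebra_simps)
    then have "(w, w') \<in> (\<lambda>(v, v'). (u * 3 ^ m + v, u' * 3 ^ m + v')) ` W u u'"
      by (intro image_eqI[where x = "(v, v')"]) (simp_all add: w)
    ultimately show ?case
      by (intro UN_I[of "(u, u')"]) simp_all
  qed
  then have "card (Z i m) \<le> card (\<Union>(u, u')\<in>J. (\<lambda>(v, v'). (u * 3 ^ m + v, u' * 3 ^ m + v')) ` W u u')"
    using finJ finW by (intro card_mono) auto
  also have "\<dots> \<le> (\<Sum>(u, u')\<in>J. card (W u u'))"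
    using card_UN_le[OF finJ, of "\<lambda>(u, u'). (\<lambda>(v, v'). (u * 3 ^ m + v, u' * 3 ^ m + v')) ` W u u'"]
    by (rule order_trans) (simp add: case_prod_unfold sum_mono card_image_le finW)
  also have "\<dots> \<le> (\<Sum>(u, u')\<in>J. 3 * card (close_pairs y m))"
    unfolding case_prod_unfold by (intro sum_mono cardW)
  also have "\<dots> = card J * (3 * card (close_pairs y m))"
    by (simp add: case_prod_unfold)
  also have "card J = (\<Sum>u\<in>?U. card (V u))"
    unfolding J_def using finV by (intro card_SigmaI) auto
  also have "real ((\<Sum>u\<in>?U. card (V u)) * (3 * card (close_pairs y m))) =
      (\<Sum>u\<in>?U. real (card (V u))) * (3 * real (card (close_pairs y m)))"
    by simp
  also have "\<dots> \<le> (\<Sum>u\<in>?U. 9 * K) * (3 * real (card (close_pairs y m)))"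
    using cardV by (intro mult_right_mono sum_mono) auto
  also have "\<dots> = real (card ?U) * (27 * K * real (card (close_pairs y m)))"
    by simp
  also have "\<dots> \<le> real (card (crowded y K (Suc i))) * (27 * K * real (card (close_pairs y m)))"
    using K by (intro mult_right_mono) (auto intro!: card_mono)
  finally show ?thesis by (simp add: algebra_simps)
qed

text \<open>Every close pair either has a first word that is uncrowded at level \<open>n\<close>, or is counted at the
  first level at which the prefix is crowded. That level is positive because a single word is no crowd.\<close>

lemma card_close_pairs_rec:
  assumes y: "0 \<le> y" "y \<le> 1" and K: "1 < K"
  shows "real (card (close_pairs y n)) \<le> 3 * K * 3 ^ n
    + 27 * K * (\<Sum>i<n. real (card (crowded y K (Suc i))) * real (card (close_pairs y (n - Suc i))))"
proof -
  let ?Z0 = "{(w, w') \<in> close_pairs y n. w \<notin> crowded y K n}"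
  define Z where "Z i = {(w, w') \<in> close_pairs y n. w div 3 ^ (n - Suc i) \<in> crowded y K (Suc i)
      \<and> w div 3 ^ Suc (n - Suc i) \<notin> crowded y K i}" for i
  have fin: "finite ?Z0" "finite (Z i)" for i
    by (rule finite_subset[OF _ finite_close_pairs[of y n]], force simp: Z_def)+
  have "close_pairs y n \<subseteq> ?Z0 \<union> (\<Union>i<n. Z i)"
  proof (clarify, goal_cases)
    case (1 w w')
    define P where "P i \<longleftrightarrow> w div 3 ^ (n - i) \<in> crowded y K i" for i
    have w: "P n" "w < 3 ^ n"
      using 1 by (auto simp: P_def close_pairs_def)
    define i where "i = (LEAST i. P i)"
    have i: "P i" "i \<le> n" and least: "\<And>j. j < i \<Longrightarrow> \<not> P j"
      unfolding i_def using w by (auto intro: LeastI Least_le dest: not_less_Least)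
    have "i \<noteq> 0"
      using i(1) crowded_0[OF K] by (auto simp: P_def intro!: Nat.gr0I)
    then obtain j where j: "i = Suc j" by (cases i) auto
    have "n - j = Suc (n - Suc j)" using i j by simp
    then have "(w, w') \<in> Z j"
      using least[of j] i 1 unfolding j by (simp add: Z_def P_def del: power_Suc)
    moreover have "j < n" using i j by simp
    ultimately show ?case using 1 by blast
  qed
  then have "card (close_pairs y n) \<le> card (?Z0 \<union> (\<Union>i<n. Z i))"
    using fin by (intro card_mono) auto
  also have "\<dots> \<le> card ?Z0 + (\<Sum>i<n. card (Z i))"
    by (intro order_trans[OF card_Un_le] add_mono card_UN_le) auto
  also have "real \<dots> \<le> 3 * K * 3 ^ n
    + (\<Sum>i<n. 27 * K * (real (card (crowded y K (Suc i))) * real (card (close_pairs y (n - Suc i)))))"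
    unfolding of_nat_add of_nat_sum
  proof (intro add_mono sum_mono)
    have "?Z0 = Sigma {w. w < 3 ^ n \<and> w \<notin> crowded y K n} (\<lambda>w. {w'. w' < 3 ^ n \<and> \<bar>pos y w - pos y w'\<bar> < 1})"
      by (auto simp: close_pairs_def)
    then have "real (card ?Z0) = (\<Sum>w | w < 3 ^ n \<and> w \<notin> crowded y K n.
        real (card {w'. w' < 3 ^ n \<and> \<bar>pos y w - pos y w'\<bar> < 1}))"
      by (simp add: card_SigmaI)
    also have "\<dots> \<le> (\<Sum>w | w < 3 ^ n \<and> w \<notin> crowded y K n. 3 * K)"
      by (intro sum_mono card_close_uncrowded) auto
    also have "\<dots> \<le> (\<Sum>w<(3::nat) ^ n. 3 * K)"
      using K by (intro sum_mono2) auto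
    finally show "real (card ?Z0) \<le> 3 * K * 3 ^ n" by (simp add: mult.commute)
  next
    fix i assume "i \<in> {..<n}"
    then have "Suc i + (n - Suc i) = n" by simp
    then show "real (card (Z i))
        \<le> 27 * K * (real (card (crowded y K (Suc i))) * real (card (close_pairs y (n - Suc i))))"
      using card_close_pairs_first_crowded[OF y, where K = K and i = i and m = "n - Suc i"] K by (simp add: Z_def del: power_Suc)
  qed
  finally show ?thesis by (simp add: sum_distrib_left)
qed

text \<open>With crowded proportion at most \<open>1 / (54 * K * N)\<close> at every level, the sum in
  \<open>card_close_pairs_rec\<close> reproduces at most half of the bound \<open>6 * K * 3 ^ n\<close>.\<close>

lemma card_close_pairs_if_few_crowded:
  assumes y: "0 \<le> y" "y \<le> 1" and K: "1 < K"
    and few: "\<And>i. i < N \<Longrightarrow> real (card (crowded y K (Suc i))) \<le> 3 ^ Suc i / (54 * K * real N)"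
  shows "n \<le> N \<Longrightarrow> real (card (close_pairs y n)) \<le> 6 * K * 3 ^ n"
proof (induction n rule: less_induct)
  case (less n)
  have "(\<Sum>i<n. real (card (crowded y K (Suc i))) * real (card (close_pairs y (n - Suc i))))
      \<le> (\<Sum>i<n. 3 ^ n / (9 * real N))"
  proof (rule sum_mono)
    fix i assume i: "i \<in> {..<n}"
    have "real (card (crowded y K (Suc i))) * real (card (close_pairs y (n - Suc i)))
        \<le> 3 ^ Suc i / (54 * K * real N) * (6 * K * 3 ^ (n - Suc i))"
      using i less K by (intro mult_mono few) auto
    also have "\<dots> = 3 ^ (Suc i + (n - Suc i)) / (9 * real N)"
      using K unfolding power_add by (simp add: field_simps)
    also have "\<dots> = 3 ^ n / (9 * real N)"
      using i by simp
    finally show "real (card (crowded y K (Suc i))) * real (card (close_pairs y (n - Suc i)))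
        \<le> 3 ^ n / (9 * real N)" .
  qed
  also have "\<dots> = (real n / real N) * (3 ^ n / 9)"
    by simp
  also have "\<dots> \<le> 1 * (3 ^ n / 9)"
    using less.prems by (intro mult_right_mono) (auto simp: divide_le_eq_1)
  finally have "27 * K * (\<Sum>i<n. real (card (crowded y K (Suc i))) * real (card (close_pairs y (n - Suc i))))
      \<le> 27 * K * (1 * (3 ^ n / 9))"
    using K by (intro mult_left_mono) auto
  then show ?case
    using card_close_pairs_rec[OF y K, of n] by simp
qed

section \<open>Crowded words make slices small\<close>

definition slice :: "real \<Rightarrow> nat \<Rightarrow> real set" where
  "slice y n = (\<Union>w<3 ^ n. {pos y w..pos y w + 1})"

lemma lmeasurable_slice [simp]: "slice y n \<in> lmeasurable"
  unfolding slice_def by (intro fmeasurable.finite_UN) auto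

lemma slice_subset: "0 \<le> y \<Longrightarrow> y \<le> 1 \<Longrightarrow> slice y n \<subseteq> {0..3 ^ n}"
  using pos_bounds[of y _ n] by (fastforce simp: slice_def)

lemma measure_slice_le:
  assumes "0 \<le> y" "y \<le> 1"
  shows "measure lebesgue (slice y n) \<le> 3 ^ n"
  using measure_mono_fmeasurable[OF slice_subset[OF assms], of n lebesgue] by (simp add: fmeasurableD)

lemma slice_concat: "slice y (i + m) = (\<Union>u<3 ^ i. (+) (3 ^ m * pos y u) ` slice y m)"
proof -
  have "slice y (i + m) = (\<Union>u<3 ^ i. \<Union>v<3 ^ m. {pos y (u * 3 ^ m + v)..pos y (u * 3 ^ m + v) + 1})"
    unfolding slice_def words_concat_image by auto
  also have "\<dots> = (\<Union>u<3 ^ i. \<Union>v<3 ^ m. (+) (3 ^ m * pos y u) ` {pos y v..pos y v + 1})"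
    by (intro SUP_cong refl) (simp add: pos_concat add.assoc)
  finally show ?thesis by (simp add: slice_def image_UN)
qed

text \<open>Every uncrowded prefix contributes a translate of the slice of level \<open>m\<close>. The translates belonging
  to crowded prefixes are contained in intervals of length \<open>4 * 3 ^ m\<close> around the boxes with at least \<open>K\<close>
  words, and since all words in these boxes are crowded, there are at most \<open>card (crowded y K i) / K\<close>
  such boxes.\<close>

lemma measure_slice_rec:
  assumes y: "0 \<le> y" "y \<le> 1" and K: "0 < K"
  shows "measure lebesgue (slice y (i + m))
    \<le> (3 ^ i - real (card (crowded y K i))) * measure lebesgue (slice y m)
      + 4 / K * real (card (crowded y K i)) * 3 ^ m"
proof -
  let ?C = "crowded y K i"
  define U where "U = {..<3 ^ i} - ?C"
  define B where "B = {b \<in> (\<lambda>w. \<lfloor>pos y w\<rfloor>) ` {..<3 ^ i}. K \<le> real (box_count y i b)}"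
  define F where "F u = (+) (3 ^ m * pos y u) ` slice y m" for u
  define G where "G b = {3 ^ m * (real_of_int b - 1)..3 ^ m * (real_of_int b + 3)}" for b
  have fin: "finite U" "finite B" by (auto simp: U_def B_def)
  have F: "F u \<in> lmeasurable" "measure lebesgue (F u) = measure lebesgue (slice y m)" for u
    by (simp_all add: F_def measurable_translation measure_translation)
  have sub: "?C \<subseteq> {..<3 ^ i}" by (auto simp: crowded_def)
  have "slice y (i + m) \<subseteq> (\<Union>u\<in>U. F u) \<union> (\<Union>b\<in>B. G b)"
  proof
    fix x assume "x \<in> slice y (i + m)"
    then obtain u where u: "u < 3 ^ i" "x \<in> F u"
      unfolding slice_concat F_def by auto
    show "x \<in> (\<Union>u\<in>U. F u) \<union> (\<Union>b\<in>B. G b)"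
    proof (cases "u \<in> ?C")
      case True
      then obtain b where b: "\<bar>b - \<lfloor>pos y u\<rfloor>\<bar> \<le> 1" "K \<le> real (box_count y i b)"
        by (auto simp: crowded_def)
      have "box_count y i b \<noteq> 0"
        using b(2) K by auto
      then have "b \<in> B"
        using b(2) unfolding B_def box_count_def by (auto simp: card_eq_0_iff)
      have b_near: "real_of_int b - 1 \<le> pos y u" "pos y u + 1 \<le> real_of_int b + 3"
        using b(1) by linarith+
      have "3 ^ m * pos y u \<le> x" "x \<le> 3 ^ m * (pos y u + 1)"
        using u(2) slice_subset[OF y, of m] by (auto simp: F_def algebra_simps)
      moreover have "3 ^ m * (real_of_int b - 1) \<le> 3 ^ m * pos y u"
        "3 ^ m * (pos y u + 1) \<le> 3 ^ m * (real_of_int b + 3)"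
        using b_near by (intro mult_left_mono; simp)+
      ultimately have "x \<in> G b"
        unfolding G_def atLeastAtMost_iff by linarith
      with \<open>b \<in> B\<close> show ?thesis by auto
    qed (use u in \<open>auto simp: U_def\<close>)
  qed
  then have "measure lebesgue (slice y (i + m)) \<le> measure lebesgue ((\<Union>u\<in>U. F u) \<union> (\<Union>b\<in>B. G b))"
    using fin F by (intro measure_mono_fmeasurable fmeasurable.Un fmeasurable.finite_UN fmeasurableD)
      (auto simp: G_def)
  also have "\<dots> \<le> measure lebesgue (\<Union>u\<in>U. F u) + measure lebesgue (\<Union>b\<in>B. G b)"
    using fin F by (intro measure_Un_le sets.finite_UN fmeasurableD) (auto simp: G_def)
  also have "\<dots> \<le> (\<Sum>u\<in>U. measure lebesgue (F u)) + (\<Sum>b\<in>B. measure lebesgue (G b))"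
    using fin F by (intro add_mono measure_UNION_le fmeasurableD) (auto simp: G_def)
  also have "\<dots> = real (card U) * measure lebesgue (slice y m) + 4 * real (card B) * 3 ^ m"
    unfolding F(2) by (simp add: G_def algebra_simps)
  also have "real (card U) = 3 ^ i - real (card ?C)"
    using sub card_mono[OF _ sub] by (simp add: U_def card_Diff_subset of_nat_diff)
  also have "real (card B) \<le> real (card ?C) / K"
  proof -
    have "K * real (card B) \<le> (\<Sum>b\<in>B. real (box_count y i b))"
      using sum_bounded_below[of B K "\<lambda>b. real (box_count y i b)"] by (auto simp: B_def mult.commute)
    also have "\<dots> = real (card (\<Union>b\<in>B. {w. w < 3 ^ i \<and> \<lfloor>pos y w\<rfloor> = b}))"
      unfolding box_count_def using fin by (subst card_UN_disjoint) auto
    also have "\<dots> \<le> real (card ?C)"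
      by (intro of_nat_mono card_mono) (auto simp: crowded_def B_def intro!: exI[of _ "\<lfloor>pos y _\<rfloor>"])
    finally show ?thesis using K by (simp add: field_simps)
  qed
  finally show ?thesis by (simp add: mult_right_mono)
qed

text \<open>Bernoulli's inequality and \<open>(1 - d) * (1 + d) \<le> 1\<close>.\<close>

lemma power_one_minus_le:
  assumes "0 < d" "d \<le> (1::real)" "k \<le> real l * d" "0 < k"
  shows "(1 - d) ^ l \<le> 1 / k"
proof -
  have "(1 - d) ^ l * k \<le> (1 - d) ^ l * (1 + d) ^ l"
    using Bernoulli_inequality[of d l] assms by (intro mult_left_mono) auto
  also have "\<dots> = (1 - d\<^sup>2) ^ l"
    by (simp add: power2_eq_square algebra_simps flip: power_mult_distrib)
  also have "\<dots> \<le> 1"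
    using assms by (intro power_le_one) (auto simp: abs_square_le_1)
  finally show ?thesis using assms by (simp add: field_simps)
qed

text \<open>In terms of the relative lengths \<open>a m = measure lebesgue (slice y m) / 3 ^ m\<close>, the recursion reads
  \<open>a (i + m) \<le> (1 - d) * a m + 4 * d / K\<close>, with fixed point \<open>4 / K\<close>. It is essential that the second term
  carries the factor \<open>d\<close>: the bound does not deteriorate however small the crowded proportion is, only
  the number of iterations grows.\<close>

lemma measure_slice_decay:
  assumes y: "0 \<le> y" "y \<le> 1" and K: "0 < K" and i: "0 < i" "i \<le> N"
    and D: "0 < D" "3 ^ i / D \<le> real (card (crowded y K i))"
    and n: "real N * (K * D + 1) \<le> real n"
  shows "measure lebesgue (slice y n) \<le> 5 / K * 3 ^ n"
proof -
  define d where "d = real (card (crowded y K i)) / 3 ^ i"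
  have "card (crowded y K i) \<le> card {..<(3::nat) ^ i}"
    by (intro card_mono) (auto simp: crowded_def)
  then have "d \<le> 1"
    by (simp add: d_def divide_le_eq_1)
  have "1 / D \<le> d"
    using D by (simp add: d_def field_simps)
  moreover have "0 < 1 / D" using D by simp
  ultimately have "0 < d" by linarith
  have iter: "measure lebesgue (slice y (i * l + r)) \<le> ((1 - d) ^ l + 4 / K) * 3 ^ (i * l + r)" for l r
  proof (induction l)
    case 0
    have "measure lebesgue (slice y r) \<le> 1 * 3 ^ r"
      using measure_slice_le[OF y, of r] by simp
    also have "\<dots> \<le> (1 + 4 / K) * 3 ^ r"
      using K by (intro mult_right_mono) auto
    finally show ?case by simp
  next
    case (Suc l)
    let ?m = "i * l + r"
    have card: "real (card (crowded y K i)) = d * 3 ^ i"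
      by (simp add: d_def)
    have "measure lebesgue (slice y (i + ?m))
        \<le> (3 ^ i - d * 3 ^ i) * measure lebesgue (slice y ?m) + 4 / K * (d * 3 ^ i) * 3 ^ ?m"
      using measure_slice_rec[OF y K, of i ?m] unfolding card .
    also have "\<dots> \<le> (3 ^ i - d * 3 ^ i) * (((1 - d) ^ l + 4 / K) * 3 ^ ?m) + 4 / K * (d * 3 ^ i) * 3 ^ ?m"
      using \<open>d \<le> 1\<close> by (intro add_mono order_refl mult_left_mono Suc.IH) (auto simp: mult_le_cancel_right1)
    also have "\<dots> = ((1 - d) ^ Suc l + 4 / K) * (3 ^ i * 3 ^ ?m)"
      using K by (simp add: field_simps)
    finally show ?case
      by (simp add: add.assoc flip: power_add)
  qed
  define l where "l = n div i"
  have "real N * (K * D + 1) < real N * (real l + 1)"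
  proof -
    have "n < i * (l + 1)"
      using i by (simp add: l_def dividend_less_times_div)
    then have "real n < real i * (real l + 1)"
      by (metis of_nat_less_iff of_nat_mult of_nat_add of_nat_1)
    also have "\<dots> \<le> real N * (real l + 1)"
      using i by (intro mult_right_mono) auto
    finally show ?thesis using n by linarith
  qed
  then have "K * D \<le> real l"
    by (simp add: mult_less_cancel_left)
  then have "K * D * (1 / D) \<le> real l * d"
    using \<open>1 / D \<le> d\<close> D by (intro mult_mono) auto
  then have "(1 - d) ^ l \<le> 1 / K"
    using \<open>0 < d\<close> \<open>d \<le> 1\<close> K D by (intro power_one_minus_le) auto
  then have "((1 - d) ^ l + 4 / K) * 3 ^ n \<le> 5 / K * 3 ^ n"
    by (intro mult_right_mono) (auto simp: field_simps)
  moreover have "i * l + n mod i = n" by (simp add: l_def)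
  ultimately show ?thesis
    using iter[of l "n mod i"] by simp
qed

section \<open>The energy of the exponential sum\<close>

text \<open>Its mean squares with suitable weights count pairs of words according to the distance of their left
  ends, while self-similarity turns it into a product.\<close>

definition exp_sum :: "real \<Rightarrow> nat \<Rightarrow> real \<Rightarrow> complex" where
  "exp_sum y n \<xi> = (\<Sum>w<3 ^ n. cis (\<xi> * pos y w))"

lemma exp_sum_concat: "exp_sum y (i + m) \<xi> = exp_sum y i (3 ^ m * \<xi>) * exp_sum y m \<xi>"
proof -
  have "exp_sum y (i + m) \<xi>
      = (\<Sum>(u, v)\<in>{..<3 ^ i} \<times> {..<3 ^ m}. cis (\<xi> * pos y (u * 3 ^ m + v)))"
    unfolding exp_sum_def words_concat_image
    by (subst sum.reindex[OF inj_on_concat]) (simp add: case_prod_unfold)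
  also have "\<dots> = (\<Sum>(u, v)\<in>{..<3 ^ i} \<times> {..<3 ^ m}. cis (3 ^ m * \<xi> * pos y u) * cis (\<xi> * pos y v))"
    unfolding cis_mult by (intro sum.cong refl) (auto simp: pos_concat distrib_left mult_ac)
  also have "\<dots> = exp_sum y i (3 ^ m * \<xi>) * exp_sum y m \<xi>"
    by (simp add: exp_sum_def sum_product sum.cartesian_product)
  finally show ?thesis .
qed

lemma exp_sum_1: "exp_sum y 1 \<xi> = 1 + cis (\<xi> * (1 + y)) + cis (\<xi> * (2 - y))"
proof -
  have "{..<3 ^ 1} = {0, Suc 0, 2 :: nat}" by auto
  then show ?thesis by (simp add: exp_sum_def pos_digit)
qed

lemma cmod_cis_sum_square:
  fixes f :: "'a \<Rightarrow> real"
  shows "(cmod (\<Sum>a\<in>A. cis (\<xi> * f a)))\<^sup>2 = (\<Sum>a\<in>A. \<Sum>b\<in>A. cos (\<xi> * (f a - f b)))"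
  unfolding cmod_power2
  by (simp add: power2_eq_square sum_product right_diff_distrib cos_diff sum.distrib)

text \<open>The integral of \<open>(1 - \<xi> / X) * cos (\<xi> * t)\<close> over \<open>{0..X}\<close>. The triangular weight is chosen because
  this transform is nonnegative and decays quadratically.\<close>

definition fejer :: "real \<Rightarrow> real \<Rightarrow> real" where
  "fejer X t = (if t = 0 then X / 2 else (1 - cos (X * t)) / (X * t\<^sup>2))"

lemma has_integral_fejer:
  assumes "X > 0"
  shows "((\<lambda>\<xi>. (1 - \<xi> / X) * cos (\<xi> * t)) has_integral fejer X t) {0..X}"
proof (cases "t = 0")
  case True
  have "((\<lambda>\<xi>. 1 - \<xi> / X) has_integral (X - X\<^sup>2 / (2 * X)) - (0 - 0\<^sup>2 / (2 * X))) {0..X}"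
    using assms
    by (intro fundamental_theorem_of_calculus)
      (auto intro!: derivative_eq_intros simp flip: has_real_derivative_iff_has_vector_derivative)
  then show ?thesis
    using assms True by (simp add: fejer_def power2_eq_square)
next
  case False
  define F where "F \<xi> = (1 - \<xi> / X) * sin (\<xi> * t) / t - cos (\<xi> * t) / (X * t\<^sup>2)" for \<xi>
  have "((\<lambda>\<xi>. (1 - \<xi> / X) * cos (\<xi> * t)) has_integral F X - F 0) {0..X}"
    unfolding F_def using assms False
    by (intro fundamental_theorem_of_calculus)
      (auto intro!: derivative_eq_intros simp: field_simps power2_eq_square
        simp flip: has_real_derivative_iff_has_vector_derivative)
  moreover have "F X - F 0 = fejer X t"
    using assms False by (simp add: F_def fejer_def diff_divide_distrib)
  ultimately show ?thesis by simp
qed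

lemma fejer_nonneg: "X > 0 \<Longrightarrow> 0 \<le> fejer X t"
  by (simp add: fejer_def)

lemma fejer_2_le: "fejer 2 t \<le> 1" "t \<noteq> 0 \<Longrightarrow> fejer 2 t \<le> 1 / t\<^sup>2"
proof -
  have eq: "fejer 2 t = (sin t / t)\<^sup>2" if "t \<noteq> 0"
    using that cos_double_sin[of t] by (simp add: fejer_def power_divide)
  have "\<bar>sin t\<bar> \<le> \<bar>t\<bar>" by (rule abs_sin_x_le_abs_x)
  then have "\<bar>sin t / t\<bar> \<le> 1" if "t \<noteq> 0"
    using that by simp
  then show "fejer 2 t \<le> 1"
    using eq by (cases "t = 0") (simp_all add: fejer_def abs_square_le_1)
  show "fejer 2 t \<le> 1 / t\<^sup>2" if "t \<noteq> 0"
    unfolding eq[OF that] power_divide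
    by (intro divide_right_mono) (auto simp: abs_square_le_1)
qed

lemma has_integral_fejer_energy:
  fixes f :: "'a \<Rightarrow> real"
  assumes "finite A" "X > 0"
  shows "((\<lambda>\<xi>. (1 - \<xi> / X) * (cmod (\<Sum>a\<in>A. cis (\<xi> * f a)))\<^sup>2) has_integral
    (\<Sum>a\<in>A. \<Sum>b\<in>A. fejer X (f a - f b))) {0..X}"
  unfolding cmod_cis_sum_square sum_distrib_left
  using assms by (intro has_integral_sum has_integral_fejer) auto

lemma energy_integrable: "(\<lambda>\<xi>. (cmod (exp_sum y n \<xi>))\<^sup>2) integrable_on {a..b}"
  unfolding exp_sum_def by (intro integrable_continuous_real continuous_intros)

text \<open>All terms of the Fejer-weighted mean square are nonnegative, and the diagonal pairs alone give this
  bound.\<close>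

lemma energy_lower:
  assumes "X > 0"
  shows "X / 2 * 3 ^ n \<le> integral {0..X} (\<lambda>\<xi>. (cmod (exp_sum y n \<xi>))\<^sup>2)"
proof -
  have "X / 2 * 3 ^ n = (\<Sum>w<(3::nat) ^ n. fejer X (pos y w - pos y w))"
    by (simp add: fejer_def)
  also have "\<dots> \<le> (\<Sum>w<3 ^ n. \<Sum>w'<3 ^ n. fejer X (pos y w - pos y w'))"
    by (rule sum_mono, rule member_le_sum) (use assms fejer_nonneg in auto)
  also have "\<dots> \<le> integral {0..X} (\<lambda>\<xi>. (cmod (exp_sum y n \<xi>))\<^sup>2)"
  proof (rule has_integral_le)
    show "((\<lambda>\<xi>. (1 - \<xi> / X) * (cmod (exp_sum y n \<xi>))\<^sup>2) has_integral
        (\<Sum>w<3 ^ n. \<Sum>w'<3 ^ n. fejer X (pos y w - pos y w'))) {0..X}"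
      unfolding exp_sum_def using assms by (intro has_integral_fejer_energy) auto
    show "((\<lambda>\<xi>. (cmod (exp_sum y n \<xi>))\<^sup>2) has_integral
        integral {0..X} (\<lambda>\<xi>. (cmod (exp_sum y n \<xi>))\<^sup>2)) {0..X}"
      by (rule integrable_integral[OF energy_integrable])
  qed (use assms in \<open>auto intro!: mult_left_le_one_le\<close>)
  finally show ?thesis .
qed

lemma sum_inverse_squares_le: "(\<Sum>h=1..n. 1 / (real h)\<^sup>2) \<le> 2"
proof -
  have "(\<Sum>h=1..n. 1 / (real h)\<^sup>2) \<le> 2 - 1 / real n" if "n > 0"
    using that
  proof (induction n rule: nat_induct_non_zero)
    case (Suc n)
    have "1 / (real (Suc n))\<^sup>2 \<le> 1 / (real n * real (Suc n))"
      using Suc(1) unfolding power2_eq_square by (intro divide_left_mono mult_right_mono) auto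
    also have "\<dots> = 1 / real n - 1 / real (Suc n)"
      using Suc(1) by (simp add: field_simps)
    finally have "1 / (real (Suc n))\<^sup>2 \<le> 1 / real n - 1 / real (Suc n)" .
    with Suc show ?case by simp
  qed simp
  then show ?thesis by (cases "n = 0") (auto intro: order_trans)
qed

text \<open>A weight of quadratic decay is dominated by a combination of indicators of intervals of length \<open>2\<close>,
  with summable coefficients.\<close>

lemma fejer_2_le_sum:
  assumes "\<bar>t\<bar> < real H + 1"
  shows "fejer 2 t \<le> of_bool (\<bar>t\<bar> < 1)
    + (\<Sum>h=1..H. 1 / (real h)\<^sup>2 * (of_bool (\<bar>t + - (real h + 1/2)\<bar> < 1) + of_bool (\<bar>t + (real h + 1/2)\<bar> < 1)))"
    (is "_ \<le> _ + sum ?g _")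
proof (cases "\<bar>t\<bar> < 1")
  case True
  have "0 \<le> sum ?g {1..H}" by (intro sum_nonneg) auto
  with True fejer_2_le(1)[of t] show ?thesis by simp
next
  case False
  define h where "h = nat \<lfloor>\<bar>t\<bar>\<rfloor>"
  have h: "real h \<le> \<bar>t\<bar>" "\<bar>t\<bar> < real h + 1" "1 \<le> h"
    using False by (auto simp: h_def le_nat_iff)
  have "h \<in> {1..H}" using h assms by auto
  have "fejer 2 t \<le> 1 / t\<^sup>2"
    using False by (intro fejer_2_le(2)) auto
  also have "\<dots> \<le> 1 / (real h)\<^sup>2"
    using h power_mono[of "real h" "\<bar>t\<bar>" 2] by (intro divide_left_mono) auto
  also have "\<dots> \<le> ?g h"
    using h by (cases "t \<ge> 0") (auto simp: field_simps abs_if of_bool_def)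
  also have "\<dots> \<le> sum ?g {1..H}"
    using \<open>h \<in> {1..H}\<close> by (intro member_le_sum) auto
  finally show ?thesis by simp
qed

lemma sum_of_bool_pairs:
  assumes "finite A" "finite B"
  shows "(\<Sum>a\<in>A. \<Sum>b\<in>B. of_bool (P a b)) = real (card {(a, b). a \<in> A \<and> b \<in> B \<and> P a b})"
proof -
  have "(\<Sum>a\<in>A. \<Sum>b\<in>B. of_bool (P a b) :: real) = (\<Sum>a\<in>A. real (card {b \<in> B. P a b}))"
    using assms by (simp add: of_bool_def sum.If_cases Int_def)
  also have "\<dots> = real (card (Sigma A (\<lambda>a. {b \<in> B. P a b})))"
    using assms by (simp add: card_SigmaI)
  also have "Sigma A (\<lambda>a. {b \<in> B. P a b}) = {(a, b). a \<in> A \<and> b \<in> B \<and> P a b}"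
    by auto
  finally show ?thesis .
qed

text \<open>By \<open>fejer_2_le_sum\<close> the weighted mean square is bounded by numbers of pairs that are close up to an
  offset, each at most three times the number of close pairs. The constant is
  \<open>26 = 2 * (1 + 2 * 6)\<close>: the weight is at least \<open>1 / 2\<close> on \<open>{0..1}\<close>, the inverse squares sum to at
  most \<open>2\<close>, and each coefficient comes with two offsets.\<close>

lemma energy_upper:
  assumes y: "0 \<le> y" "y \<le> 1"
  shows "integral {0..1} (\<lambda>\<xi>. (cmod (exp_sum y n \<xi>))\<^sup>2) \<le> 26 * real (card (close_pairs y n))"
proof -
  let ?E = "\<lambda>\<xi>. (cmod (exp_sum y n \<xi>))\<^sup>2"
  let ?T = "real (card (close_pairs y n))"
  let ?A = "{..<(3::nat) ^ n}"
  define c where "c t = (\<Sum>w\<in>?A. \<Sum>w'\<in>?A. of_bool (\<bar>pos y w - pos y w' + t\<bar> < 1) :: real)" for t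
  have c: "c t \<le> 3 * ?T" for t
    using card_offset_close_le[of n y t] unfolding c_def by (subst sum_of_bool_pairs) auto
  have c0: "c 0 = ?T"
    unfolding c_def by (subst sum_of_bool_pairs) (auto simp: close_pairs_def)
  have fejer: "((\<lambda>\<xi>. (1 - \<xi> / 2) * ?E \<xi>) has_integral
      (\<Sum>w\<in>?A. \<Sum>w'\<in>?A. fejer 2 (pos y w - pos y w'))) {0..2}"
    unfolding exp_sum_def by (intro has_integral_fejer_energy) auto
  then have int: "(\<lambda>\<xi>. (1 - \<xi> / 2) * ?E \<xi>) integrable_on {0..2}"
    by blast
  have "integral {0..1} ?E \<le> integral {0..1} (\<lambda>\<xi>. 2 * ((1 - \<xi> / 2) * ?E \<xi>))"
  proof (rule integral_le)
    show "(\<lambda>\<xi>. 2 * ((1 - \<xi> / 2) * ?E \<xi>)) integrable_on {0..1}"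
      by (intro integrable_on_mult_right integrable_subinterval_real[OF int]) auto
    show "?E \<xi> \<le> 2 * ((1 - \<xi> / 2) * ?E \<xi>)" if "\<xi> \<in> {0..1}" for \<xi>
      using that mult_right_mono[of 1 "2 * (1 - \<xi> / 2)" "?E \<xi>"] by (simp add: algebra_simps)
  qed (rule energy_integrable)
  also have "\<dots> = 2 * integral {0..1} (\<lambda>\<xi>. (1 - \<xi> / 2) * ?E \<xi>)"
    by simp
  also have "\<dots> \<le> 2 * integral {0..2} (\<lambda>\<xi>. (1 - \<xi> / 2) * ?E \<xi>)"
    by (intro mult_left_mono integral_subset_le integrable_subinterval_real[OF int] int) auto
  also have "integral {0..2} (\<lambda>\<xi>. (1 - \<xi> / 2) * ?E \<xi>) = (\<Sum>w\<in>?A. \<Sum>w'\<in>?A. fejer 2 (pos y w - pos y w'))"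
    using fejer by (rule integral_unique)
  also have "\<dots> \<le> (\<Sum>w\<in>?A. \<Sum>w'\<in>?A. of_bool (\<bar>pos y w - pos y w'\<bar> < 1)
    + (\<Sum>h=1..3 ^ n. 1 / (real h)\<^sup>2 * (of_bool (\<bar>pos y w - pos y w' + - (real h + 1/2)\<bar> < 1)
        + of_bool (\<bar>pos y w - pos y w' + (real h + 1/2)\<bar> < 1))))"
  proof (intro sum_mono fejer_2_le_sum)
    fix w w' assume "w \<in> ?A" "w' \<in> ?A"
    then show "\<bar>pos y w - pos y w'\<bar> < real (3 ^ n) + 1"
      using pos_bounds[OF y, of w n] pos_bounds[OF y, of w' n] by auto
  qed
  also have "\<dots> = c 0 + (\<Sum>h=1..3 ^ n. 1 / (real h)\<^sup>2 * (c (- (real h + 1/2)) + c (real h + 1/2)))"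
  proof -
    have swap: "(\<Sum>w\<in>?A. \<Sum>w'\<in>?A. F w w' + (\<Sum>h=1..3 ^ n. a h * (G w w' h + H w w' h)))
        = (\<Sum>w\<in>?A. \<Sum>w'\<in>?A. F w w')
          + (\<Sum>h=1..3 ^ n. a h * ((\<Sum>w\<in>?A. \<Sum>w'\<in>?A. G w w' h) + (\<Sum>w\<in>?A. \<Sum>w'\<in>?A. H w w' h)))"
      for F :: "nat \<Rightarrow> nat \<Rightarrow> real" and G H :: "nat \<Rightarrow> nat \<Rightarrow> nat \<Rightarrow> real" and a :: "nat \<Rightarrow> real"
      by (simp add: sum.distrib sum_distrib_left distrib_left sum.swap[of _ "{Suc 0..3 ^ n}"])
    show ?thesis
      unfolding swap c_def by (simp only: add_0_right)
  qed
  also have "\<dots> \<le> ?T + (\<Sum>h=1..3 ^ n. 1 / (real h)\<^sup>2 * (3 * ?T + 3 * ?T))"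
    unfolding c0 by (intro add_mono order_refl sum_mono mult_left_mono c) auto
  also have "\<dots> = ?T + (\<Sum>h=1..3 ^ n. 1 / (real h)\<^sup>2) * (6 * ?T)"
    by (simp add: sum_distrib_right)
  also have "\<dots> \<le> ?T + 2 * (6 * ?T)"
    by (intro add_mono order_refl mult_right_mono sum_inverse_squares_le) auto
  finally show ?thesis by simp
qed

section \<open>Frequencies at which the exponential sum is not small\<close>

text \<open>With \<open>c = cmod (1 + cis a)\<close> one has \<open>c\<^sup>2 - 1 = 1 + 2 * cos a\<close>, and the third summand can lower the
  modulus to no less than \<open>\<bar>c - 1\<bar>\<close>. The bound does not involve \<open>b\<close>, which makes it independent of
  all relations between the two frequencies.\<close>

lemma cmod_trinomial_lower: "\<bar>1 + 2 * cos a\<bar> \<le> 3 * cmod (1 + cis a + cis b)"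
proof -
  define c where "c = cmod (1 + cis a)"
  have "c\<^sup>2 = (1 + cos a)\<^sup>2 + (sin a)\<^sup>2"
    by (simp add: c_def cmod_power2)
  also have "\<dots> = 2 + 2 * cos a"
    using sin_cos_squared_add[of a] by (simp add: power2_eq_square algebra_simps)
  finally have "1 + 2 * cos a = (c - 1) * (c + 1)"
    by (simp add: power2_eq_square algebra_simps)
  moreover have "0 \<le> c" by (simp add: c_def)
  ultimately have "\<bar>1 + 2 * cos a\<bar> = \<bar>c - 1\<bar> * (c + 1)"
    by (simp add: abs_mult)
  also have "\<dots> \<le> \<bar>c - 1\<bar> * 3"
    using norm_triangle_ineq[of 1 "cis a"] by (intro mult_left_mono) (auto simp: c_def)
  also have "\<bar>c - 1\<bar> \<le> cmod (1 + cis a + cis b)"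
    using norm_triangle_ineq3[of "1 + cis a" "- cis b"] by (simp add: c_def)
  finally show ?thesis by simp
qed

lemma sin_triple: "sin (3 * x) = (1 + 2 * cos (2 * x)) * sin (x::real)"
proof -
  have "sin (3 * x) = sin (2 * x + x)" by (simp add: algebra_simps)
  also have "\<dots> = (1 + 2 * cos (2 * x)) * sin x"
    unfolding sin_add cos_double_sin sin_double
    using sin_cos_squared_add[of x] by algebra
  finally show ?thesis .
qed

text \<open>The product of the lower bounds \<open>cmod_trinomial_lower\<close> telescopes by \<open>sin_triple\<close>. By symmetry of
  the trinomial, both nonzero digits can serve as \<open>g\<close>.\<close>

lemma exp_sum_lower_sin:
  assumes "g \<in> {1 + y, 2 - y}"
  shows "\<bar>sin (3 ^ n * (g * \<xi> / 2))\<bar> \<le> 3 ^ n * cmod (exp_sum y n \<xi>) * \<bar>sin (g * \<xi> / 2)\<bar>"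
proof (induction n)
  case 0
  show ?case by (simp add: exp_sum_def)
next
  case (Suc n)
  let ?x = "3 ^ n * (g * \<xi> / 2)"
  have "\<bar>1 + 2 * cos (t * (1 + y))\<bar> \<le> 3 * cmod (exp_sum y 1 t)"
    "\<bar>1 + 2 * cos (t * (2 - y))\<bar> \<le> 3 * cmod (exp_sum y 1 t)" for t
    unfolding exp_sum_1
    using cmod_trinomial_lower[of "t * (1 + y)" "t * (2 - y)"]
      cmod_trinomial_lower[of "t * (2 - y)" "t * (1 + y)"] by (simp_all add: add_ac)
  then have "\<bar>1 + 2 * cos (3 ^ n * \<xi> * g)\<bar> \<le> 3 * cmod (exp_sum y 1 (3 ^ n * \<xi>))"
    using assms by auto
  moreover have "2 * ?x = 3 ^ n * \<xi> * g" by simp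
  ultimately have factor: "\<bar>1 + 2 * cos (2 * ?x)\<bar> \<le> 3 * cmod (exp_sum y 1 (3 ^ n * \<xi>))"
    by (simp only:)
  have "\<bar>sin (3 ^ Suc n * (g * \<xi> / 2))\<bar> = \<bar>1 + 2 * cos (2 * ?x)\<bar> * \<bar>sin ?x\<bar>"
    using sin_triple[of ?x] by (simp add: abs_mult mult.assoc)
  also have "\<dots> \<le> (3 * cmod (exp_sum y 1 (3 ^ n * \<xi>))) *
      (3 ^ n * cmod (exp_sum y n \<xi>) * \<bar>sin (g * \<xi> / 2)\<bar>)"
    by (intro mult_mono factor Suc.IH) auto
  also have "\<dots> = 3 ^ Suc n * cmod (exp_sum y (1 + n) \<xi>) * \<bar>sin (g * \<xi> / 2)\<bar>"
    unfolding exp_sum_concat norm_mult by simp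
  finally show ?case by simp
qed

lemma exp_sum_lower_small:
  assumes y: "0 \<le> y" "y \<le> 1" and "\<bar>\<xi>\<bar> * 3 ^ n \<le> 1 / 2"
  shows "3 ^ n / 2 \<le> cmod (exp_sum y n \<xi>)"
proof -
  have "cmod (3 ^ n - exp_sum y n \<xi>) = cmod (\<Sum>w<(3::nat) ^ n. 1 - cis (\<xi> * pos y w))"
    by (simp add: exp_sum_def sum_subtractf)
  also have "\<dots> \<le> (\<Sum>w<(3::nat) ^ n. 1 / 2)"
  proof (rule sum_norm_le)
    fix w :: nat assume "w \<in> {..<3 ^ n}"
    then have w: "0 \<le> pos y w" "pos y w \<le> 3 ^ n"
      using pos_bounds[OF y, of w n] by auto
    have "cmod (1 - cis (\<xi> * pos y w)) \<le> \<bar>\<xi> * pos y w\<bar>"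
      using dist_exp_i_1[of "\<xi> * pos y w"] abs_sin_x_le_abs_x[of "\<xi> * pos y w / 2"]
      by (simp add: cis_conv_exp norm_minus_commute)
    also have "\<dots> \<le> \<bar>\<xi>\<bar> * 3 ^ n"
      using w by (simp add: abs_mult mult_left_mono)
    also have "\<dots> \<le> 1 / 2" by fact
    finally show "cmod (1 - cis (\<xi> * pos y w)) \<le> 1 / 2" .
  qed
  finally have "cmod (3 ^ n - exp_sum y n \<xi>) \<le> 3 ^ n / 2" by simp
  moreover have "3 ^ n = cmod (3 ^ n)" by (simp add: norm_power)
  ultimately show ?thesis
    using norm_triangle_ineq2[of "3 ^ n" "exp_sum y n \<xi>"] by linarith
qed

text \<open>The two half-angles are those of \<open>exp_sum_lower_sin\<close> for the two nonzero digits; the bounds obtained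
  from them fail together only if both \<open>(1 + y) * \<tau>\<close> and \<open>(2 - y) * \<tau>\<close> are near multiples of \<open>2 * pi\<close>.\<close>

definition nonresonant :: "real \<Rightarrow> real \<Rightarrow> real \<Rightarrow> bool" where
  "nonresonant X \<eta> y \<longleftrightarrow>
    (\<forall>\<tau>\<in>{1..X}. \<eta> \<le> \<bar>sin ((1 + y) * \<tau> / 2)\<bar> \<or> \<eta> \<le> \<bar>sin ((2 - y) * \<tau> / 2)\<bar>)"

text \<open>At the frequency \<open>\<tau> / 3 ^ i\<close> the first \<open>Suc L\<close> levels see the phases \<open>\<tau> / 3, \<tau> / 9, \<dots>\<close> and are estimated
  by the telescoping product. The remaining \<open>i - Suc L\<close> levels have phases so small that the sum is at
  least half of its value at \<open>0\<close>.\<close>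

lemma exp_sum_lower_nonresonant:
  assumes y: "0 \<le> y" "y \<le> 1" and "nonresonant (3 ^ L) \<eta> y"
    and \<tau>: "1 \<le> \<tau>" "\<tau> \<le> 3 ^ L" and i: "Suc L \<le> i"
  shows "\<eta> * 3 ^ i / (18 * 9 ^ L) \<le> cmod (exp_sum y i (\<tau> / 3 ^ i))"
proof -
  define m where "m = i - Suc L"
  have m: "i = Suc L + m" using i by (simp add: m_def)
  obtain g where g: "g \<in> {1 + y, 2 - y}" "\<eta> \<le> \<bar>sin (g * \<tau> / 2)\<bar>"
    using assms(3) \<tau> unfolding nonresonant_def by fastforce
  have "\<eta> \<le> \<bar>sin (3 ^ Suc L * (g * (\<tau> / 3 ^ Suc L) / 2))\<bar>"
    using g(2) by (simp add: mult.commute)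
  also have "\<dots> \<le> 3 ^ Suc L * cmod (exp_sum y (Suc L) (\<tau> / 3 ^ Suc L)) * \<bar>sin (g * (\<tau> / 3 ^ Suc L) / 2)\<bar>"
    by (rule exp_sum_lower_sin[OF g(1)])
  also have "\<dots> \<le> 3 ^ Suc L * cmod (exp_sum y (Suc L) (\<tau> / 3 ^ Suc L)) * 1"
    by (intro mult_left_mono) auto
  finally have high: "\<eta> / 3 ^ Suc L \<le> cmod (exp_sum y (Suc L) (\<tau> / 3 ^ Suc L))"
    by (simp add: field_simps)
  have low: "3 ^ m / 2 \<le> cmod (exp_sum y m (\<tau> / 3 ^ i))"
    using \<tau> by (intro exp_sum_lower_small y) (simp add: m power_add field_simps)
  have "\<eta> * 3 ^ i / (18 * 9 ^ L) = \<eta> / 3 ^ Suc L * (3 ^ m / 2)"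
    by (simp add: m power_add field_simps flip: power_mult_distrib)
  also have "\<dots> \<le> cmod (exp_sum y (Suc L) (\<tau> / 3 ^ Suc L)) * cmod (exp_sum y m (\<tau> / 3 ^ i))"
    by (intro mult_mono high low) auto
  also have "\<dots> = cmod (exp_sum y i (\<tau> / 3 ^ i))"
  proof -
    have "3 ^ m * (\<tau> / 3 ^ i) = \<tau> / 3 ^ Suc L"
      by (simp add: m power_add)
    then show ?thesis
      unfolding m exp_sum_concat norm_mult by (simp only: m)
  qed
  finally show ?thesis .
qed

section \<open>A non-resonant height has many crowded words\<close>

text \<open>On the window the exponential sum factors into the part estimated by \<open>exp_sum_lower_nonresonant\<close> and,
  after rescaling the frequency by \<open>3 ^ i\<close>, the sum over words of length \<open>N - i\<close> on \<open>{1..3 ^ L}\<close>. The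
  hypothesis on close pairs ensures that the mean square of the latter is not concentrated on \<open>{0..1}\<close>.\<close>

lemma window_energy_lower:
  assumes y: "0 \<le> y" "y \<le> 1" and nonres: "nonresonant (3 ^ L) \<eta> y" and "0 \<le> \<eta>"
    and i: "Suc L \<le> i" "i \<le> N"
    and close: "104 * real (card (close_pairs y (N - i))) \<le> 3 ^ L * 3 ^ (N - i)"
  shows "\<eta>\<^sup>2 / (1296 * 81 ^ L) * 3 ^ L * 3 ^ N
    \<le> integral {1 / 3 ^ i..3 ^ L / 3 ^ i} (\<lambda>\<xi>. (cmod (exp_sum y N \<xi>))\<^sup>2)"
proof -
  define k where "k = \<eta> * 3 ^ i / (18 * 9 ^ L)"
  let ?E = "\<lambda>n \<xi>. (cmod (exp_sum y n \<xi>))\<^sup>2"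
  have "k \<ge> 0" using \<open>0 \<le> \<eta>\<close> by (simp add: k_def)
  have "integral {0..1} (?E (N - i)) + integral {1..3 ^ L} (?E (N - i)) = integral {0..3 ^ L} (?E (N - i))"
    by (intro Henstock_Kurzweil_Integration.integral_combine energy_integrable) auto
  then have "3 ^ L / 4 * 3 ^ (N - i) \<le> integral {1..3 ^ L} (?E (N - i))"
    using energy_lower[of "3 ^ L" "N - i" y] energy_upper[OF y, of "N - i"] close by simp
  then have "k\<^sup>2 * (3 ^ L / 4 * 3 ^ (N - i)) \<le> k\<^sup>2 * integral {1..3 ^ L} (?E (N - i))"
    by (intro mult_left_mono) auto
  also have "\<dots> = integral {1..3 ^ L} (\<lambda>\<tau>. k\<^sup>2 * ?E (N - i) \<tau>)"
    by simp
  also have "\<dots> \<le> integral {1..3 ^ L} (\<lambda>\<tau>. ?E N (\<tau> / 3 ^ i))"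
  proof (rule integral_le)
    show "(\<lambda>\<tau>. k\<^sup>2 * ?E (N - i) \<tau>) integrable_on {1..3 ^ L}"
      by (intro integrable_on_mult_right energy_integrable)
    show "(\<lambda>\<tau>. ?E N (\<tau> / 3 ^ i)) integrable_on {1..3 ^ L}"
      unfolding exp_sum_def by (intro integrable_continuous_real continuous_intros) auto
    fix \<tau> :: real assume \<tau>: "\<tau> \<in> {1..3 ^ L}"
    have "k \<le> cmod (exp_sum y i (\<tau> / 3 ^ i))"
      unfolding k_def using \<tau> i by (intro exp_sum_lower_nonresonant y nonres) auto
    then have "k\<^sup>2 \<le> ?E i (\<tau> / 3 ^ i)"
      using \<open>k \<ge> 0\<close> by (intro power_mono)
    then have "k\<^sup>2 * ?E (N - i) \<tau> \<le> ?E i (\<tau> / 3 ^ i) * ?E (N - i) \<tau>"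
      by (intro mult_right_mono) auto
    also have "\<dots> = ?E N (\<tau> / 3 ^ i)"
      using exp_sum_concat[of y "N - i" i "\<tau> / 3 ^ i"] i
      by (simp add: norm_mult power_mult_distrib)
    finally show "k\<^sup>2 * ?E (N - i) \<tau> \<le> ?E N (\<tau> / 3 ^ i)" .
  qed
  also have "\<dots> = 3 ^ i * integral {1 / 3 ^ i..3 ^ L / 3 ^ i} (?E N)"
  proof -
    have "(\<lambda>x. x / (1 / 3 ^ i)) ` {1 / 3 ^ i..3 ^ L / 3 ^ i} = {1..3 ^ L :: real}"
    proof -
      have "(\<lambda>x. x / (1 / 3 ^ i)) = (\<lambda>x::real. 3 ^ i * x)" by (simp add: fun_eq_iff mult.commute)
      then show ?thesis by (simp only: image_mult_atLeastAtMost) simp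
    qed
    with integral_stretch_real[of "1 / 3 ^ i" "1 / 3 ^ i" "3 ^ L / 3 ^ i" "?E N"]
    show ?thesis by simp
  qed
  finally have "k\<^sup>2 * (3 ^ L / 4 * 3 ^ (N - i)) / 3 ^ i \<le> integral {1 / 3 ^ i..3 ^ L / 3 ^ i} (?E N)"
    by (simp add: field_simps)
  also have "k\<^sup>2 * (3 ^ L / 4 * 3 ^ (N - i)) / 3 ^ i = \<eta>\<^sup>2 / (1296 * 81 ^ L) * 3 ^ L * (3 ^ i * 3 ^ (N - i))"
  proof -
    have "(81::real) ^ L = 9 ^ L * 9 ^ L" by (simp flip: power_mult_distrib)
    then show ?thesis by (simp add: k_def power2_eq_square field_simps)
  qed
  also have "(3::real) ^ i * 3 ^ (N - i) = 3 ^ N"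
    using i by (simp flip: power_add)
  finally show ?thesis .
qed

text \<open>The windows with \<open>i = Suc L * Suc j\<close> do not overlap, because the upper end \<open>3 ^ L / 3 ^ i\<close> is below
  the lower end of the preceding window.\<close>

lemma disjoint_windows_integral:
  fixes f :: "real \<Rightarrow> real"
  assumes int: "\<And>a b. f integrable_on {a..b}" and nonneg: "\<And>x. 0 \<le> f x"
    and window: "\<And>j. j < J \<Longrightarrow> c \<le> integral {1 / 3 ^ (Suc L * Suc j)..3 ^ L / 3 ^ (Suc L * Suc j)} f"
  shows "real J * c \<le> integral {0..1} f"
proof -
  have "real j * c \<le> integral {1 / 3 ^ (Suc L * j)..1} f" if "j \<le> J" for j
    using that
  proof (induction j)
    case (Suc j)
    let ?a = "1 / 3 ^ (Suc L * Suc j) :: real" and ?b = "3 ^ L / 3 ^ (Suc L * Suc j) :: real"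
      and ?c = "1 / 3 ^ (Suc L * j) :: real"
    have le: "?a \<le> ?b" "?b \<le> ?c" "?c \<le> 1"
      by (simp add: divide_right_mono, simp add: power_add field_simps, simp add: field_simps)
    have "real (Suc j) * c \<le> integral {?a..?b} f + integral {?c..1} f"
      using Suc window[of j] by (simp add: algebra_simps)
    also have "\<dots> \<le> integral {?a..?b} f + (integral {?b..?c} f + integral {?c..1} f)"
      using integral_nonneg[OF int nonneg, of ?b ?c] by simp
    also have "integral {?b..?c} f + integral {?c..1} f = integral {?b..1} f"
      by (intro Henstock_Kurzweil_Integration.integral_combine le int)
    also have "integral {?a..?b} f + integral {?b..1} f = integral {?a..1} f"
      by (rule Henstock_Kurzweil_Integration.integral_combine[OF le(1) order.trans[OF le(2,3)] int])
    finally show ?case .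
  qed simp
  from this[of J] have "real J * c \<le> integral {1 / 3 ^ (Suc L * J)..1} f" by simp
  also have "\<dots> \<le> integral {0..1} f"
    using nonneg by (intro integral_subset_le int) auto
  finally show ?thesis .
qed

text \<open>If crowded words were rare at all levels, the energy on \<open>{0..1}\<close> would be at most \<open>X / 4 * 3 ^ N\<close>,
  whereas each of the \<open>3 ^ (10 * L + 7)\<close> windows contributes \<open>X * 3 ^ N / (1296 * X ^ 10)\<close>. The
  constant \<open>624 = 104 * 6\<close> is what \<open>window_energy_lower\<close> requires of \<open>6 * K * 3 ^ n\<close> close pairs, and
  \<open>6 \<le> L\<close> is equivalent to \<open>1 < K\<close>.\<close>

lemma many_crowded_if_nonresonant:
  fixes L :: nat
  defines "X \<equiv> 3 ^ L :: real"
  defines "K \<equiv> X / 624" and "N \<equiv> Suc L * 3 ^ (10 * L + 7)"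
  assumes y: "0 \<le> y" "y \<le> 1" and L: "6 \<le> L" and nonres: "nonresonant X (1 / X ^ 3) y"
  shows "\<exists>i<N. 3 ^ Suc i / (54 * K * real N) < real (card (crowded y K (Suc i)))"
proof (rule ccontr)
  assume "\<not> ?thesis"
  then have few: "real (card (crowded y K (Suc i))) \<le> 3 ^ Suc i / (54 * K * real N)" if "i < N" for i
    using that by (meson not_less)
  have "(3::real) ^ 6 \<le> X"
    unfolding X_def using L by (intro power_increasing) auto
  then have X: "729 \<le> X" by simp
  then have K: "1 < K" by (simp add: K_def)
  have close: "real (card (close_pairs y n)) \<le> 6 * K * 3 ^ n" if "n \<le> N" for n
    using card_close_pairs_if_few_crowded[OF y K few that] by simp
  define J :: nat where "J = 3 ^ (10 * L + 7)"
  let ?E = "\<lambda>\<xi>. (cmod (exp_sum y N \<xi>))\<^sup>2"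
  define c where "c = (1 / X ^ 3)\<^sup>2 / (1296 * 81 ^ L) * 3 ^ L * 3 ^ N"
  have "real J * c \<le> integral {0..1} ?E"
  proof (rule disjoint_windows_integral[where L = L])
    fix j assume j: "j < J"
    define i where "i = Suc L * Suc j"
    have "i \<le> N" unfolding i_def N_def J_def[symmetric]
      using j by (intro mult_left_mono) auto
    moreover have "Suc L \<le> i" by (simp add: i_def)
    moreover have "104 * real (card (close_pairs y (N - i))) \<le> 3 ^ L * 3 ^ (N - i)"
      using close[of "N - i"] by (simp add: K_def X_def)
    ultimately have "c \<le> integral {1 / 3 ^ i..3 ^ L / 3 ^ i} ?E"
      unfolding c_def using X nonres
      by (intro window_energy_lower y) (auto simp: X_def)
    then show "c \<le> integral {1 / 3 ^ (Suc L * Suc j)..3 ^ L / 3 ^ (Suc L * Suc j)} ?E"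
      by (simp only: i_def)
  qed (auto intro: energy_integrable)
  also have "\<dots> \<le> 26 * (6 * K * 3 ^ N)"
    using energy_upper[OF y, of N] close[of N] by simp
  also have "\<dots> = X / 4 * 3 ^ N"
    by (simp add: K_def)
  also have "real J * c = (27 / 16) * (X * 3 ^ N)"
  proof -
    have "(81::real) ^ L = X ^ 4"
    proof -
      have "X ^ 4 = (3 ^ 4) ^ L" unfolding X_def by (metis power_mult mult.commute)
      then show ?thesis by simp
    qed
    moreover have "real J = 2187 * X ^ 10"
      by (simp add: J_def X_def power_add mult.commute[of 10] flip: power_mult)
    ultimately have "real J * c = 2187 * X ^ 10 / (X ^ 6 * (1296 * X ^ 4)) * X * 3 ^ N"
      unfolding c_def X_def[symmetric] by (simp add: power_divide flip: power_mult)
    also have "\<dots> = (27 / 16) * (X * 3 ^ N)"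
      using X by (simp flip: power_add)
    finally show ?thesis .
  qed
  finally show False
    using X by simp
qed

section \<open>Resonant heights are rare\<close>

lemma abs_le_2_abs_sin:
  assumes "\<bar>x\<bar> \<le> pi / 2"
  shows "\<bar>x\<bar> \<le> 2 * \<bar>sin x\<bar>"
proof -
  have pos: "x \<le> 2 * sin x" if "0 \<le> x" "x \<le> pi / 2" for x :: real
  proof -
    \<comment> \<open>The derivative \<open>2 * cos t - 1\<close> is nonnegative up to \<open>pi / 3\<close>; beyond, \<open>2 * sin x\<close> is at least
      \<open>sqrt 3\<close>, which exceeds \<open>pi / 2\<close>.\<close>
    have "2 * sin 0 - 0 \<le> 2 * sin x - x" if "x \<le> pi / 3"
    proof (rule DERIV_nonneg_imp_nondecreasing[where f = "\<lambda>t. 2 * sin t - t"])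
      fix t assume t: "0 \<le> t" "t \<le> x"
      have "1 / 2 \<le> cos t"
        using cos_monotone_0_pi_le[of t "pi / 3"] t that by (simp add: cos_60)
      then show "\<exists>D. ((\<lambda>t. 2 * sin t - t) has_real_derivative D) (at t) \<and> 0 \<le> D"
        by (intro exI[of _ "2 * cos t - 1"]) (auto intro!: derivative_eq_intros)
    qed fact
    moreover have "x \<le> 2 * sin x" if "pi / 3 < x"
    proof -
      have "sqrt 3 / 2 \<le> sin x"
        using sin_monotone_2pi_le[of "pi / 3" x] that \<open>x \<le> pi / 2\<close> pi_gt_zero by (simp add: sin_60)
      moreover have "1.7 \<le> sqrt 3" by (rule real_le_rsqrt) (simp add: power2_eq_square)
      moreover have "pi / 2 \<le> 1.7" using pi_less_4 pi_approx by simp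
      ultimately show ?thesis using \<open>x \<le> pi / 2\<close> by linarith
    qed
    ultimately show ?thesis by force
  qed
  show ?thesis
    using assms pos[of x] pos[of "- x"] by (cases "0 \<le> x") auto
qed

text \<open>The nearest integer to \<open>s / pi\<close> does it, since \<open>\<bar>x\<bar> \<le> 2 * \<bar>sin x\<bar>\<close> for \<open>\<bar>x\<bar> \<le> pi / 2\<close>.\<close>

lemma near_multiple_of_pi:
  obtains k :: int where "\<bar>s - pi * of_int k\<bar> \<le> 2 * \<bar>sin s\<bar>"
proof
  define k where "k = round (s / pi)"
  have "\<bar>of_int k - s / pi\<bar> \<le> 1 / 2"
    unfolding k_def by (rule of_int_round_abs_le)
  then have "pi * \<bar>of_int k - s / pi\<bar> \<le> pi * (1 / 2)"
    by (intro mult_left_mono) auto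
  also have "pi * \<bar>of_int k - s / pi\<bar> = \<bar>s - pi * of_int k\<bar>"
    by (simp add: abs_mult_pos' algebra_simps abs_minus_commute)
  finally have "\<bar>s - pi * of_int k\<bar> \<le> 2 * \<bar>sin (s - pi * of_int k)\<bar>"
    by (intro abs_le_2_abs_sin) simp
  also have "sin (s - pi * of_int k) = sin s * cos (pi * of_int k)"
    by (simp add: sin_diff)
  also have "\<bar>\<dots>\<bar> = \<bar>sin s\<bar>"
    by (simp add: abs_mult cos_npi_int)
  finally show "\<bar>s - pi * of_int k\<bar> \<le> 2 * \<bar>sin s\<bar>" .
qed

text \<open>The \<open>2 * \<eta>\<close>-neighbourhood of the heights \<open>y\<close> with \<open>(1 + y) / 3 = p / r\<close>.\<close>

definition resonant_set :: "nat \<Rightarrow> real \<Rightarrow> real set" where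
  "resonant_set M \<eta> = (\<Union>r\<in>{1..M}. \<Union>p\<in>{..r}.
     {3 * real p / real r - 1 - 2 * \<eta>..3 * real p / real r - 1 + 2 * \<eta>})"

lemma lmeasurable_resonant_set: "resonant_set M \<eta> \<in> lmeasurable"
  unfolding resonant_set_def by (intro fmeasurable.finite_UN) auto

lemma measure_resonant_set:
  assumes "0 \<le> \<eta>" "1 \<le> M"
  shows "measure lebesgue (resonant_set M \<eta>) \<le> 8 * (real M)\<^sup>2 * \<eta>"
proof -
  have "measure lebesgue (resonant_set M \<eta>) \<le> (\<Sum>r=1..M. \<Sum>p\<le>r. 4 * \<eta>)"
    unfolding resonant_set_def
    using assms by (intro measure_UNION_le[THEN order_trans] sum_mono sets.finite_UN) auto
  also have "\<dots> \<le> (\<Sum>r=1..M. (2 * real M) * (4 * \<eta>))"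
  proof (rule sum_mono)
    fix r assume "r \<in> {1..M}"
    then have "(real r + 1) * (4 * \<eta>) \<le> 2 * real M * (4 * \<eta>)"
      using assms by (intro mult_right_mono) auto
    then show "(\<Sum>p\<le>r. 4 * \<eta>) \<le> 2 * real M * (4 * \<eta>)"
      by (simp add: add.commute)
  qed
  also have "\<dots> = 8 * (real M)\<^sup>2 * \<eta>"
    by (simp add: power2_eq_square)
  finally show ?thesis .
qed

text \<open>At a resonance \<open>(1 + y) * \<tau> / 2\<close> and \<open>(2 - y) * \<tau> / 2\<close> are near \<open>pi * p\<close> and \<open>pi * q\<close>. The digits add up
  to \<open>3\<close>, so \<open>(1 + y) / 3\<close> is near \<open>p / (p + q)\<close>; and \<open>p + q \<le> M\<close> as \<open>\<tau>\<close> is at most \<open>M\<close>.\<close>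

lemma nonresonant_if_notin_resonant_set:
  assumes y: "0 \<le> y" "y \<le> 1" and M: "1 \<le> M" and \<eta>: "0 < \<eta>" "\<eta> \<le> 1 / 10"
    and "y \<notin> resonant_set M \<eta>"
  shows "nonresonant (real M) \<eta> y"
proof (rule ccontr)
  assume "\<not> nonresonant (real M) \<eta> y"
  then obtain \<tau> where \<tau>: "1 \<le> \<tau>" "\<tau> \<le> real M"
    and sin: "\<bar>sin ((1 + y) * \<tau> / 2)\<bar> < \<eta>" "\<bar>sin ((2 - y) * \<tau> / 2)\<bar> < \<eta>"
    by (auto simp: nonresonant_def not_le)
  obtain p :: int where "\<bar>(1 + y) * \<tau> / 2 - pi * p\<bar> \<le> 2 * \<bar>sin ((1 + y) * \<tau> / 2)\<bar>"
    by (rule near_multiple_of_pi)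
  with sin(1) have p: "\<bar>(1 + y) * \<tau> / 2 - pi * p\<bar> \<le> 2 * \<eta>" by linarith
  obtain q :: int where "\<bar>(2 - y) * \<tau> / 2 - pi * q\<bar> \<le> 2 * \<bar>sin ((2 - y) * \<tau> / 2)\<bar>"
    by (rule near_multiple_of_pi)
  with sin(2) have q: "\<bar>(2 - y) * \<tau> / 2 - pi * q\<bar> \<le> 2 * \<eta>" by linarith
  define e1 e2 where "e1 = (1 + y) * \<tau> / 2 - pi * p" and "e2 = (2 - y) * \<tau> / 2 - pi * q"
  have e: "\<bar>e1\<bar> \<le> 2 * \<eta>" "\<bar>e2\<bar> \<le> 2 * \<eta>"
    using p q by (simp_all add: e1_def e2_def)
  have prod: "1 \<le> (1 + y) * \<tau>" "1 \<le> (2 - y) * \<tau>"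
    using mult_mono[of 1 "1 + y" 1 \<tau>] mult_mono[of 1 "2 - y" 1 \<tau>] y \<tau> by auto
  have "0 < pi * (of_int p + 1)" "0 < pi * (of_int q + 1)"
    using prod p q \<eta> pi_gt3 unfolding distrib_left by linarith+
  then have pq: "0 \<le> p" "0 \<le> q"
    by (simp_all add: zero_less_mult_iff)
  define r where "r = p + q"
  \<comment> \<open>This is where the sum \<open>3\<close> of the two nonzero digits enters.\<close>
  have pi_r: "pi * of_int r = 3 * \<tau> / 2 - e1 - e2"
    by (simp add: r_def e1_def e2_def field_simps)
  have "0 < pi * of_int r"
    unfolding pi_r using \<tau> e \<eta> by linarith
  then have r: "0 < r"
    by (simp add: zero_less_mult_iff)
  have "3 * real_of_int r \<le> pi * of_int r"
    using r pi_gt3 by (intro mult_right_mono) auto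
  then have "real_of_int r \<le> real M"
    unfolding pi_r using \<tau> e \<eta> M by linarith
  then have rM: "r \<le> int M" by linarith
  have "pi * \<bar>(1 + y) * of_int r - 3 * of_int p\<bar> = \<bar>(1 + y) * (pi * of_int r) - 3 * (pi * of_int p)\<bar>"
    by (simp add: abs_mult_pos' algebra_simps)
  also have "\<dots> = \<bar>(2 - y) * e1 - (1 + y) * e2\<bar>"
    unfolding pi_r by (simp add: e1_def field_simps)
  also have "\<dots> \<le> (2 - y) * \<bar>e1\<bar> + (1 + y) * \<bar>e2\<bar>"
    using y abs_triangle_ineq4[of "(2 - y) * e1" "(1 + y) * e2"] by (simp add: abs_mult)
  also have "\<dots> \<le> (2 - y) * (2 * \<eta>) + (1 + y) * (2 * \<eta>)"
    using y by (intro add_mono mult_left_mono e) auto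
  also have "\<dots> = 3 * (2 * \<eta>)"
    by (simp add: algebra_simps)
  also have "\<dots> \<le> pi * (2 * \<eta>)"
    using pi_gt3 \<eta> by (intro mult_right_mono) auto
  finally have "\<bar>(1 + y) * of_int r - 3 * of_int p\<bar> \<le> 2 * \<eta>"
    by simp
  moreover have "(1 + y) * of_int r - 3 * of_int p = (y - (3 * of_int p / of_int r - 1)) * of_int r"
    using r by (simp add: field_simps)
  ultimately have "\<bar>y - (3 * of_int p / of_int r - 1)\<bar> * of_int r \<le> 2 * \<eta>"
    using r by (simp add: abs_mult)
  moreover have "\<bar>y - (3 * of_int p / of_int r - 1)\<bar> * 1 \<le> \<bar>y - (3 * of_int p / of_int r - 1)\<bar> * of_int r"
    using r by (intro mult_left_mono) auto
  ultimately have "\<bar>y - (3 * of_int p / of_int r - 1)\<bar> \<le> 2 * \<eta>"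
    unfolding mult_1_right by (rule order_trans[rotated])
  moreover have "nat r \<in> {1..M}" "nat p \<in> {..nat r}"
    using r rM pq by (auto simp: r_def)
  moreover have "real (nat r) = of_int r" "real (nat p) = of_int p"
    using r pq by auto
  ultimately have "y \<in> resonant_set M \<eta>"
    unfolding resonant_set_def by (intro UN_I[of "nat r"] UN_I[of "nat p"]) auto
  with assms show False by simp
qed

text \<open>The exponent of the final power law comes from here: with \<open>N \<le> 3 ^ (11 * L + 7)\<close> levels and crowded
  proportion at least \<open>1 / (54 * K * N)\<close>, the decay takes at most \<open>N * (54 * K\<^sup>2 * N + 1)\<close> levels,
  which is at most \<open>3 ^ (24 * L + 14)\<close>.\<close>

lemma measure_slice_nonresonant:
  assumes y: "0 \<le> y" "y \<le> 1" "y \<notin> resonant_set (3 ^ L) (1 / 3 ^ (3 * L))"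
    and L: "6 \<le> L" and n: "3 ^ (24 * L + 14) \<le> n"
  shows "measure lebesgue (slice y n) \<le> 3120 / 3 ^ L * 3 ^ n"
proof -
  define X :: real where "X = 3 ^ L"
  define K where "K = X / 624"
  define N where "N = Suc L * 3 ^ (10 * L + 7)"
  have "(3::real) ^ 6 \<le> X"
    unfolding X_def using L by (intro power_increasing) auto
  then have X: "729 \<le> X" by simp
  then have K: "0 < K" by (simp add: K_def)
  have "nonresonant (real (3 ^ L)) (1 / 3 ^ (3 * L)) y"
  proof (intro nonresonant_if_notin_resonant_set y)
    have "(3::real) ^ 3 \<le> 3 ^ (3 * L)" using L by (intro power_increasing) auto
    then show "1 / 3 ^ (3 * L) \<le> (1 / 10 :: real)" by (simp add: field_simps)
  qed auto
  then have "nonresonant X (1 / X ^ 3) y"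
    by (simp add: X_def mult.commute flip: power_mult)
  then obtain i where i: "i < N" "3 ^ Suc i / (54 * K * real N) < real (card (crowded y K (Suc i)))"
    using many_crowded_if_nonresonant[OF y(1,2) L] unfolding X_def K_def N_def by blast
  have "L < 3 ^ L" by (rule less_exp[THEN less_le_trans]) (simp add: power_mono)
  then have "N \<le> 3 ^ L * 3 ^ (10 * L + 7)"
    unfolding N_def by (intro mult_right_mono) auto
  also have "\<dots> = 3 ^ (11 * L + 7)"
    by (simp flip: power_add)
  finally have N: "real N \<le> 3 ^ (11 * L + 7)"
    by (metis of_nat_le_iff of_nat_power of_nat_numeral)
  have "real N * (K * (54 * K * real N) + 1) \<le> 3 ^ (11 * L + 7) * 3 ^ (13 * L + 7)"
  proof (intro mult_mono N)
    have "K * (54 * K * real N) = 54 / 389376 * (X\<^sup>2 * real N)"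
      by (simp add: K_def power2_eq_square)
    also have "\<dots> \<le> 1 / 2 * (X\<^sup>2 * 3 ^ (11 * L + 7))"
      using N by (intro mult_mono) auto
    also have "X\<^sup>2 * 3 ^ (11 * L + 7) = 3 ^ (13 * L + 7)"
      by (simp add: X_def mult.commute[of L] flip: power_mult power_add)
    finally have "K * (54 * K * real N) \<le> 1 / 2 * 3 ^ (13 * L + 7)" .
    moreover have "(3::real) ^ 1 \<le> 3 ^ (13 * L + 7)"
      by (intro power_increasing) auto
    ultimately show "K * (54 * K * real N) + 1 \<le> 3 ^ (13 * L + 7)" by simp
  qed (use K in auto)
  also have "\<dots> = 3 ^ (24 * L + 14)"
    by (simp flip: power_add)
  also have "\<dots> \<le> real n"
    using n by (metis of_nat_le_iff of_nat_power of_nat_numeral)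
  finally have "real N * (K * (54 * K * real N) + 1) \<le> real n" .
  then have "measure lebesgue (slice y n) \<le> 5 / K * 3 ^ n"
    using i K by (intro measure_slice_decay[OF y(1,2) K, of "Suc i" N "54 * K * real N"]) auto
  then show ?thesis by (simp add: K_def X_def)
qed

section \<open>Integration over the heights\<close>

lemma pos_eq_digit_sum:
  "m < 3 ^ n \<Longrightarrow> pos y m = (\<Sum>k=1..n. digit_weight y (ternary_digit m k) * 3 ^ (k - 1))"
proof (induction n arbitrary: m)
  case (Suc n)
  define d b where "d = m div 3 ^ n" and "b = m mod 3 ^ n"
  have d: "d < 3"
    using Suc.prems by (simp add: d_def less_mult_imp_div_less)
  have b: "b < 3 ^ n" and m: "m = d * 3 ^ n + b"
    unfolding b_def d_def by (simp, simp only: div_mult_mod_eq)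
  have same_digit: "ternary_digit b k = ternary_digit m k" if "k \<in> {1..n}" for k
  proof -
    have "n = (k - 1) + Suc (n - k)" using that by simp
    then have "(3::nat) ^ n = 3 ^ (k - 1) * (3 * 3 ^ (n - k))"
      by (metis power_Suc power_add)
    then have "b div 3 ^ (k - 1) = m div 3 ^ (k - 1) mod (3 * 3 ^ (n - k))"
      unfolding b_def by (simp add: mod_mult2_eq)
    then have "b div 3 ^ (k - 1) mod 3 = m div 3 ^ (k - 1) mod 3"
      by (simp only: mod_mod_cancel[OF dvd_triv_left])
    then show ?thesis by (simp add: ternary_digit_def)
  qed
  have "pos y m = 3 ^ n * digit_weight y d + pos y b"
    using pos_concat[OF b, of y d] d by (simp add: m pos_digit)
  also have "pos y b = (\<Sum>k=1..n. digit_weight y (ternary_digit m k) * 3 ^ (k - 1))"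
    using Suc.IH[OF b] same_digit by simp
  also have "digit_weight y d = digit_weight y (ternary_digit m (Suc n))"
    using d by (simp add: ternary_digit_def d_def)
  finally show ?case by simp
qed simp

text \<open>The left side of the \<open>j\<close>-th parallelogram interpolates linearly between \<open>j - 1\<close> and \<open>digit_swap n j - 1\<close>,
  and both are digit sums.\<close>

lemma slice_left_end:
  assumes "j \<in> {1..3 ^ n}"
  shows "real j - 1 + (real (digit_swap n j) - real j) * y = pos y (j - 1)"
proof -
  have "real (j - 1) = (\<Sum>k=1..n. real (ternary_digit (j - 1) k) * 3 ^ (k - 1))"
  proof -
    have "j - 1 < 3 ^ n" using assms by auto
    then have "(\<Sum>k=1..n. ternary_digit (j - 1) k * 3 ^ (k - 1)) = j - 1"
      by (simp only: sum_ternary_digit mod_less)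
    from arg_cong[OF this, of real] show ?thesis by simp
  qed
  then have j: "real j = 1 + (\<Sum>k=1..n. real (ternary_digit (j - 1) k) * 3 ^ (k - 1))"
    using assms by simp
  have s: "real (digit_swap n j)
      = 1 + (\<Sum>k=1..n. real (2 * ternary_digit (j - 1) k mod 3) * 3 ^ (k - 1))"
    using assms by (simp add: digit_swap_def)
  have "pos y (j - 1) = (\<Sum>k=1..n. digit_weight y (ternary_digit (j - 1) k) * 3 ^ (k - 1))"
    using assms by (intro pos_eq_digit_sum) auto
  then show ?thesis
    unfolding j s digit_weight_def
    by (simp add: algebra_simps sum_distrib_left sum.distrib sum_subtractf)
qed

lemma parallelogram_union_section:
  "(\<lambda>x. (x, y)) -` parallelogram_union (3 ^ n) (digit_swap n)
    = (if y \<in> {0..1} then (\<lambda>x. x / 3 ^ n) ` slice y n else {})"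
proof (cases "y \<in> {0..1}")
  case True
  have "(x, y) \<in> parallelogram_union (3 ^ n) (digit_swap n) \<longleftrightarrow> 3 ^ n * x \<in> slice y n" for x
  proof -
    have "(x, y) \<in> parallelogram_union (3 ^ n) (digit_swap n) \<longleftrightarrow>
        (\<exists>j\<in>{1..3 ^ n}. 3 ^ n * x \<in> {pos y (j - 1)..pos y (j - 1) + 1})"
      unfolding parallelogram_union_def UN_iff
    proof (rule bex_cong[OF refl])
      fix j :: nat assume j: "j \<in> {1..3 ^ n}"
      show "(x, y) \<in> parallelogram (3 ^ n) j (digit_swap n j)
          \<longleftrightarrow> 3 ^ n * x \<in> {pos y (j - 1)..pos y (j - 1) + 1}"
        using True slice_left_end[OF j, of y, symmetric] by (auto simp: parallelogram_def)
    qed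
    also have "{1..3 ^ n} = Suc ` {..<3 ^ n}"
      by (simp add: image_Suc_lessThan)
    finally show ?thesis by (simp add: slice_def)
  qed
  moreover have "x \<in> (\<lambda>x. x / 3 ^ n) ` slice y n \<longleftrightarrow> 3 ^ n * x \<in> slice y n" for x
    by (auto intro!: image_eqI[of x _ "3 ^ n * x"])
  ultimately show ?thesis using True by auto
qed (auto simp: parallelogram_union_def parallelogram_def)

lemma emeasure_lborel_eq_measure_lebesgue:
  fixes S :: "'a::euclidean_space set"
  assumes "S \<in> sets borel" "S \<in> lmeasurable"
  shows "emeasure lborel S = ennreal (measure lebesgue S)"
proof -
  have "emeasure lborel S = emeasure lebesgue S" using assms(1) by simp
  also have "\<dots> = ennreal (measure lebesgue S)"
    using assms(2) by (rule emeasure_eq_measure2)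
  finally show ?thesis .
qed

lemma emeasure_section:
  "emeasure lborel ((\<lambda>x. x / 3 ^ n) ` slice y n) = ennreal (measure lebesgue (slice y n) / 3 ^ n)"
proof -
  have eq: "(\<lambda>x. x / 3 ^ n) ` slice y n = (\<lambda>x. (1 / 3 ^ n) *\<^sub>R x + 0) ` slice y n"
    by (intro image_cong) auto
  have "compact (slice y n)"
    unfolding slice_def by (intro compact_UN) auto
  then have "compact ((\<lambda>x. x / 3 ^ n) ` slice y n)"
    by (intro compact_continuous_image continuous_intros) auto
  then have "emeasure lborel ((\<lambda>x. x / 3 ^ n) ` slice y n)
      = ennreal (measure lebesgue ((\<lambda>x. x / 3 ^ n) ` slice y n))"
    by (intro emeasure_lborel_eq_measure_lebesgue borel_compact lmeasurable_compact)
  then show ?thesis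
    unfolding eq measure_lebesgue_affine by simp
qed

text \<open>Slices over resonant heights are bounded by the trivial length \<open>1\<close>. For \<open>L < 6\<close> the right-hand
  side exceeds \<open>1\<close>, so \<open>n\<close> has to be large only from \<open>L = 6\<close> on.\<close>

lemma area_le:
  assumes n: "6 \<le> L \<Longrightarrow> 3 ^ (24 * L + 14) \<le> n"
  shows "measure lebesgue (parallelogram_union (3 ^ n) (digit_swap n)) \<le> 3128 / 3 ^ L"
proof -
  let ?T = "parallelogram_union (3 ^ n) (digit_swap n)"
  let ?R = "resonant_set (3 ^ L) (1 / 3 ^ (3 * L))"
  define c :: real where "c = 3120 / 3 ^ L"
  have "c \<ge> 0" by (simp add: c_def)
  have slice_le: "measure lebesgue (slice y n) / 3 ^ n \<le> indicator ?R y + c" if y: "y \<in> {0..1}" for y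
  proof (cases "6 \<le> L \<and> y \<notin> ?R")
    case True
    then have "measure lebesgue (slice y n) \<le> c * 3 ^ n"
      using measure_slice_nonresonant[of y L n] n y by (simp add: c_def)
    then show ?thesis using True by (simp add: field_simps)
  next
    case False
    have "measure lebesgue (slice y n) / 3 ^ n \<le> 1"
      using measure_slice_le[of y n] y by simp
    moreover have "1 \<le> indicator ?R y + c"
    proof (cases "y \<in> ?R")
      case not_in: False
      with False have "(3::real) ^ L \<le> 3 ^ 5" by (intro power_increasing) auto
      then show ?thesis using not_in by (simp add: c_def field_simps)
    qed (use \<open>c \<ge> 0\<close> in simp)
    ultimately show ?thesis by linarith
  qed
  have R: "?R \<in> sets borel"
    unfolding resonant_set_def by auto
  have "compact ?T"
    unfolding parallelogram_union_def by (intro compact_UN compact_parallelogram) auto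
  then have T: "?T \<in> sets (borel :: (real \<times> real) measure)"
    by (rule borel_compact)
  then have T': "?T \<in> sets (lborel \<Otimes>\<^sub>M lborel)"
    by (simp only: lborel_prod sets_lborel)
  have "emeasure lebesgue ?T = emeasure (lborel \<Otimes>\<^sub>M lborel) ?T"
    using T by (simp add: lborel_prod)
  also have "\<dots> = (\<integral>\<^sup>+y. emeasure lborel ((\<lambda>x. (x, y)) -` ?T) \<partial>lborel)"
    by (rule lborel_pair.emeasure_pair_measure_alt2[OF T'])
  also have "\<dots> \<le> (\<integral>\<^sup>+y. indicator ?R y + ennreal c * indicator {0..1} y \<partial>lborel)"
  proof (intro nn_integral_mono)
    fix y :: real
    show "emeasure lborel ((\<lambda>x. (x, y)) -` ?T) \<le> indicator ?R y + ennreal c * indicator {0..1} y"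
    proof (cases "y \<in> {0..1}")
      case True
      have "ennreal (measure lebesgue (slice y n) / 3 ^ n) \<le> ennreal (indicator ?R y + c)"
        by (intro ennreal_leI slice_le True)
      also have "\<dots> = indicator ?R y + ennreal c"
        using \<open>c \<ge> 0\<close> by (simp add: ennreal_indicator)
      finally show ?thesis
        using True by (simp add: parallelogram_union_section emeasure_section)
    next
      case False
      then show ?thesis by (simp only: parallelogram_union_section if_False) simp
    qed
  qed
  also have "\<dots> = emeasure lborel ?R + ennreal c"
    using R by (simp add: nn_integral_add nn_integral_cmult_indicator)
  also have "emeasure lborel ?R = ennreal (measure lebesgue ?R)"
    by (intro emeasure_lborel_eq_measure_lebesgue R lmeasurable_resonant_set)
  also have "ennreal (measure lebesgue ?R) + ennreal c = ennreal (measure lebesgue ?R + c)"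
    using \<open>c \<ge> 0\<close> by simp
  finally have "measure lebesgue ?T \<le> measure lebesgue ?R + c"
    unfolding measure_def[of lebesgue ?T] using \<open>c \<ge> 0\<close> by (intro enn2real_leI) auto
  also have "measure lebesgue ?R \<le> 8 * (real (3 ^ L))\<^sup>2 * (1 / 3 ^ (3 * L))"
    by (intro measure_resonant_set) auto
  also have "\<dots> = 8 / 3 ^ L"
  proof -
    have "(3::real) ^ (3 * L) = (3 ^ L) ^ 3" by (simp add: mult.commute flip: power_mult)
    then show ?thesis by (simp add: power2_eq_square power3_eq_cube)
  qed
  finally show ?thesis by (simp add: c_def)
qed

theorem proposition4:
  shows "\<exists>C p :: real. C > 0 \<and> p > 0 \<and>
    (\<forall>n::nat. n \<ge> 1 \<longrightarrow>
      measure lebesgue (parallelogram_union (3 ^ n) (digit_swap n)) \<le> C * real n powr (- p))"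
proof (intro exI conjI allI impI)
  fix n :: nat assume n: "1 \<le> n"
  let ?a = "measure lebesgue (parallelogram_union (3 ^ n) (digit_swap n))"
  show "?a \<le> 28152 * real n powr (- (1 / 24))"
  proof -
    define l where "l = nat \<lfloor>log 3 (real n)\<rfloor>"
    \<comment> \<open>The largest \<open>L\<close> that \<open>area_le\<close> admits, up to rounding; truncated subtraction gives \<open>0\<close> for
      small \<open>n\<close>.\<close>
    define L where "L = (l - 14) div 24"
    have "0 \<le> log 3 (real n)" using n by simp
    then have l: "real l \<le> log 3 (real n)" "log 3 (real n) < real l + 1"
      by (auto simp: l_def)
    have "3 powr real l \<le> real n"
      using l(1) n by (simp add: le_log_iff)
    then have "real (3 ^ l) \<le> real n" by (simp add: powr_realpow)
    then have "3 ^ l \<le> n" by (simp only: of_nat_le_iff)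
    moreover have "(3::nat) ^ (24 * L + 14) \<le> 3 ^ l" if "6 \<le> L"
    proof (rule power_increasing)
      show "24 * L + 14 \<le> l" using that unfolding L_def by linarith
    qed simp
    ultimately have "?a \<le> 3128 / 3 ^ L"
      by (intro area_le) (meson order_trans)
    also have "\<dots> = 3128 * 3 powr (- real L)"
      by (simp add: powr_minus powr_realpow field_simps)
    also have "\<dots> \<le> 3128 * (9 * real n powr (- (1 / 24)))"
    proof (intro mult_left_mono)
      have "l < 24 * L + 38" unfolding L_def by linarith
      then have "3 powr (- real L) \<le> 3 powr (2 - log 3 (real n) / 24)"
        using l(2) by (intro powr_mono) auto
      also have "\<dots> = 9 * real n powr (- (1 / 24))"
      proof -
        have "3 powr (2 - log 3 (real n) / 24) = 3 powr 2 * (3 powr log 3 (real n)) powr (- (1 / 24))"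
          using powr_add[of 3 2 "- (log 3 (real n) / 24)"] by (simp add: powr_powr)
        then show ?thesis using n by simp
      qed
      finally show "3 powr (- real L) \<le> 9 * real n powr (- (1 / 24))" .
    qed simp
    finally show ?thesis by simp
  qed
qed auto

end
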